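(* Let $G$ be a threshold graph with $n$ vertices represented by the alternating binary sequence $b_1^{q_1}\dots b_r^{q_r}$ with $q_1\ge 2$. Denote the degree sequence of $G$ by $d_n\ge\dots\ge d_1$, the eigenvalues of the signless Laplacian $Q(G)$ by $\lambda_n\ge\dots\ge\lambda_1$, and the number of ones in the binary sequence by $\bar k=\sum_{i=1}^r b_iq_i$. Then $$\lambda_n\ge d_n-1\ge\lambda_{n-1}\ge\dots\ge\lambda_{n+1-\bar k}\ge d_{n+1-\bar k}-1\ge d_{n-\bar k}\ge\lambda_{n-\bar k}\ge\dots\ge d_1\ge\lambda_1\ge 0.$$ Furthermore, if $b_1=1$ and $\bar k>q_1$, then $\lambda_{n-\bar k+q_1}\ge d_{n-\bar k+q_1}$.
   Context: The signless Laplacian of a finite simple graph $G$ is $Q(G)=D+A$, where $A$ is the adjacency matrix and $D$ the diagonal matrix of vertex degrees. A sequence $b_1^{q_1}\dots b_r^{q_r}$ with $b_k\in\{0,1\}$ and positive integers $q_k$ denotes the binary string of length $n=\sum_{k=1}^r q_k$ in which digit $b_k$ is repeated $q_k$ times in block $k$. It is alternating if $b_k+b_{k+1}=1$ for $k=1,\dots,r-1$. Put $n_0=0$ and $n_k=\sum_{h=1}^k q_h$. The threshold graph $G=([n],E)$ represented by the sequence has edge set given, for $1\le i<j\le n$, by: $\{i,j\}\in E$ if and only if there is $k\in\{1,\dots,r\}$ with $n_{k-1}<j\le n_k$ and $b_k=1$ (i.e., digit $0$ adds an isolated vertex, digit $1$ adds a vertex adjacent to all previous vertices). In the displayed chain the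 terms alternate: for indices $i=n,n-1,\dots,n+1-\bar k$ the terms are $\lambda_i\ge d_i-1$ in succession, and for indices $i=n-\bar k,\dots,1$ they are $d_i\ge\lambda_i$ in succession. If $\bar k=0$ or $\bar k=n$, the corresponding empty part of the chain (terms with indices outside $\{1,\dots,n\}$) is omitted. *)

theory Defs
  imports
    "Jordan_Normal_Form.Char_Poly"
    "Jordan_Normal_Form.Conjugate"
begin

text \<open>
  A simple graph on the vertex set \<open>{1..n}\<close> is given by its set of edges \<open>E\<close>, each edge being
  a two-element subset of \<open>{1..n}\<close>. Matrix indices start at \<open>0\<close>, so row and column \<open>i\<close> belong to
  the vertex \<open>i + 1\<close>.
\<close>

definition vertex_degree :: "nat set set \<Rightarrow> nat \<Rightarrow> nat" where
  "vertex_degree E v = card {e \<in> E. v \<in> e}"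

definition adjacency_matrix :: "nat \<Rightarrow> nat set set \<Rightarrow> real mat" where
  "adjacency_matrix n E = mat n n (\<lambda>(i, j). if {i + 1, j + 1} \<in> E then 1 else 0)"

definition degree_matrix :: "nat \<Rightarrow> nat set set \<Rightarrow> real mat" where
  "degree_matrix n E = mat_diag n (\<lambda>i. real (vertex_degree E (i + 1)))"

definition signless_laplacian :: "nat \<Rightarrow> nat set set \<Rightarrow> real mat" where
  "signless_laplacian n E = degree_matrix n E + adjacency_matrix n E"

text \<open>Both lists below are increasing and keep repetitions.\<close>

definition degree_list :: "nat \<Rightarrow> nat set set \<Rightarrow> nat list" where
  "degree_list n E = sort (map (vertex_degree E) [1..<n + 1])"

definition eigenvalue_list :: "real mat \<Rightarrow> real list" where
  "eigenvalue_list M = sorted_list_of_multiset (proots (char_poly M))"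

text \<open>
  The list above contains only real roots of the characteristic polynomial; for a symmetric matrix
  these are all its roots, see \<open>char_poly_eigenvalue_list\<close> below.
\<close>

definition nth_degree :: "nat \<Rightarrow> nat set set \<Rightarrow> nat \<Rightarrow> nat" where
  "nth_degree n E i = degree_list n E ! (i - 1)"

definition nth_eigenvalue :: "real mat \<Rightarrow> nat \<Rightarrow> real" where
  "nth_eigenvalue M i = eigenvalue_list M ! (i - 1)"

text \<open>
  The sequence \<open>b_1^{q_1} ... b_r^{q_r}\<close> is given by \<open>r\<close> and functions \<open>b\<close>, \<open>q\<close> of which only
  the values on \<open>{1..r}\<close> matter.
\<close>

definition binary_sequence :: "nat \<Rightarrow> (nat \<Rightarrow> nat) \<Rightarrow> (nat \<Rightarrow> nat) \<Rightarrow> bool" where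
  "binary_sequence r b q \<longleftrightarrow> 1 \<le> r \<and> (\<forall>k\<in>{1..r}. b k \<in> {0, 1} \<and> 0 < q k)"

definition alternating :: "nat \<Rightarrow> (nat \<Rightarrow> nat) \<Rightarrow> bool" where
  "alternating r b \<longleftrightarrow> (\<forall>k\<in>{1..<r}. b k + b (k + 1) = 1)"

definition block_end :: "(nat \<Rightarrow> nat) \<Rightarrow> nat \<Rightarrow> nat" where
  "block_end q k = (\<Sum>h=1..k. q h)"

definition threshold_edges :: "nat \<Rightarrow> (nat \<Rightarrow> nat) \<Rightarrow> (nat \<Rightarrow> nat) \<Rightarrow> nat set set" where
  "threshold_edges r b q =
     {{i, j} | i j. 1 \<le> i \<and> i < j \<and> j \<le> block_end q r \<and>
        (\<exists>k\<in>{1..r}. block_end q (k - 1) < j \<and> j \<le> block_end q k \<and> b k = 1)}"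

lemma char_poly_eigenvalue_list:
  assumes A: "A \<in> carrier_mat n n" and sym: "transpose_mat A = A"
  shows "char_poly A = (\<Prod>a\<leftarrow>eigenvalue_list A. [:- a, 1:])"
    and "length (eigenvalue_list A) = n"
    and "sorted (eigenvalue_list A)"
proof -
  define C where "C = map_mat complex_of_real A"
  have C: "C \<in> carrier_mat n n" using A by (simp add: C_def)
  have symA: "A $$ (i, j) = A $$ (j, i)" if "i < n" "j < n" for i j
    using arg_cong[OF sym, of "\<lambda>M. M $$ (i, j)"] that A by auto
  obtain as where as: "char_poly C = (\<Prod>a\<leftarrow>as. [:- a, 1:])" and len: "length as = n"
    using char_poly_factorized[OF C] by auto
  have real: "complex_of_real (Re a) = a" if a: "a \<in> set as" for a
  proof -
    have "poly (char_poly C) a = 0" unfolding as poly_prod_list prod_list_zero_iff using a by force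
    hence "eigenvalue C a" using eigenvalue_root_char_poly[OF C] by simp
    then obtain v where v: "v \<in> carrier_vec n" "v \<noteq> 0\<^sub>v n" "C *\<^sub>v v = a \<cdot>\<^sub>v v"
      using C unfolding eigenvalue_def eigenvector_def by auto
    define S where "S = (\<Sum>i<n. cnj (v $ i) * v $ i)"
    define T where "T = (\<Sum>i<n. \<Sum>j<n. cnj (v $ i) * (A $$ (i, j) * v $ j))"
    have "(\<Sum>j<n. A $$ (i, j) * v $ j) = a * v $ i" if i: "i < n" for i
      using arg_cong[OF v(3), of "\<lambda>w. w $ i"] i v(1) A
      by (simp add: C_def scalar_prod_def atLeast0LessThan)
    hence TS: "T = a * S"
      by (simp add: T_def S_def sum_distrib_left[symmetric])
        (simp add: sum_distrib_left mult_ac)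
    have "cnj T = (\<Sum>j<n. \<Sum>i<n. v $ i * (A $$ (i, j) * cnj (v $ j)))"
      unfolding T_def by (subst sum.swap) (simp add: cnj_sum)
    also have "\<dots> = T" unfolding T_def by (intro sum.cong) (auto simp: symA mult_ac)
    finally have T: "cnj T = T" .
    have S: "cnj S = S" by (simp add: S_def mult.commute)
    obtain k where k: "k < n" "v $ k \<noteq> 0" using v(1,2) by (metis eq_vecI carrier_vecD index_zero_vec)
    have "Re S = (\<Sum>i<n. (cmod (v $ i))\<^sup>2)"
      by (simp add: S_def cmod_power2) (simp add: power2_eq_square)
    also have "\<dots> > 0" by (rule sum_pos2[of _ k]) (use k in auto)
    finally have "S \<noteq> 0" by auto
    hence "cnj a = a" using TS T S by (metis complex_cnj_mult mult_cancel_right)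
    thus ?thesis by (simp add: complex_eq_iff)
  qed
  interpret m: map_poly_inj_idom_hom complex_of_real ..
  define rs where "rs = map Re as"
  have "map_poly complex_of_real (char_poly A) = char_poly C"
    unfolding C_def by (rule of_real_hom.char_poly_hom[OF A, symmetric])
  also have "\<dots> = (\<Prod>a\<leftarrow>rs. [:- complex_of_real a, 1:])"
    unfolding as rs_def by (intro arg_cong[of _ _ prod_list]) (simp add: real)
  also have "\<dots> = map_poly complex_of_real (\<Prod>a\<leftarrow>rs. [:- a, 1:])"
    by (induction rs) (simp_all add: m.hom_mult of_real_hom.map_poly_pCons_hom del: mult_pCons_left)
  finally have *: "char_poly A = (\<Prod>a\<leftarrow>rs. [:- a, 1:])" by simp
  have "0 \<notin> (\<lambda>a. [:- a, 1:]) ` set rs" by (simp add: image_iff eq_commute[of 0])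
  hence "proots (char_poly A) = mset rs"
    unfolding * using proots_prod_list[of "map (\<lambda>a. [:- a, 1:]) rs"]
    by (auto simp: comp_def)
  hence m: "mset (eigenvalue_list A) = mset rs" by (simp add: eigenvalue_list_def)
  show "char_poly A = (\<Prod>a\<leftarrow>eigenvalue_list A. [:- a, 1:])"
    unfolding * by (metis m mset_map prod_mset_prod_list)
  show "length (eigenvalue_list A) = n"
    using m len by (metis rs_def length_map size_mset)
  show "sorted (eigenvalue_list A)" by (simp add: eigenvalue_list_def)
qed

lemma signless_laplacian_symmetric:
  shows "signless_laplacian n E \<in> carrier_mat n n"
    and "transpose_mat (signless_laplacian n E) = signless_laplacian n E"
  by (auto simp: signless_laplacian_def degree_matrix_def adjacency_matrix_def mat_diag_def
      insert_commute)

end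

theory Submission
  imports Defs
begin

text \<open>
  Number the vertices \<open>0, \<dots>, n - 1\<close> in the order in which they are added and let \<open>S\<close> be the set of
  those that carry the digit \<open>1\<close>, the ones; the others are the zeros. A vertex \<open>v \<in> S\<close> is joined to
  all earlier vertices and to the later ones, a zero only to the later ones. The quadratic
  form of the signless Laplacian is \<open>edge_form S x\<close>, the sum of \<open>(x u + x v)\<^sup>2\<close> over the edges.

  By the easy half of the min-max principle (\<open>nth_eigenvalue_ge\<close>, \<open>nth_eigenvalue_le\<close>) each
  inequality between an eigenvalue and a number \<open>c\<close> follows from one subspace of the right
  codimension on which the form lies above or below \<open>c\<close> times the squared norm. The subspaces are
  explicit, and the order of the degrees turns these inequalities into the chain: from earlier to
  later ones the degree does not decrease, from earlier to later zeros it does not increase, and as the first two digits agree,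
  every one has larger degree than every zero. Let \<open>d\<close> be the degree of the vertex in question.

  \<^item> For \<open>v \<in> S\<close> the vectors supported on the ones from \<open>v\<close> on: this is a clique, and the form of a
    clique is a multiple of the squared norm plus the square of the sum of the entries. This gives
    the lower bound \<open>d - 1\<close>.

  \<^item> For \<open>v \<in> S\<close> the vectors that vanish on the ones after \<open>v\<close> and have sum \<open>0\<close> on \<open>0, \<dots>, v\<close>: adding
    edges only increases the form, so the first \<open>v + 1\<close> vertices may be replaced by a clique. This
    gives the upper bound \<open>d - 1\<close> for the next smaller eigenvalue.

  \<^item> For \<open>w \<notin> S\<close> the vectors supported on the zeros from \<open>w\<close> on: this set is independent, so the
    form is diagonal with entries at most \<open>d\<close>, and this gives the upper bound \<open>d\<close>.

  \<^item> For \<open>w \<notin> S\<close> the vectors that vanish on the zeros after \<open>w\<close> and have sum \<open>0\<close> on \<open>0, \<dots>, w\<close>: the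
    sum condition removes the mixed terms between these vertices and the later ones, and this gives
    the lower bound \<open>d\<close> for the next larger eigenvalue.

  The last claim needs one dimension more than the first kind of subspace offers above the initial
  clique. The extra dimension is spanned by the indicator of that clique, and in return the unit
  vectors of the later ones are corrected on the zero that follows the clique; see
  \<open>eig_ge_initial_clique\<close>.
\<close>

section \<open>Diagonalisation of real symmetric matrices\<close>

text \<open>
  The reflection that exchanges \<open>v\<close> and the first unit vector. It supplies an orthogonal matrix with
  a prescribed unit vector as first column, which the deflation step below needs.
\<close>

lemma householder_reflection:
  fixes v :: "real vec"
  assumes v: "v \<in> carrier_vec n" and unit: "v \<bullet> v = 1" and n: "0 < n"
  obtains H where "H \<in> carrier_mat n n" "transpose_mat H = H" "H * H = 1\<^sub>m n"
    "H *\<^sub>v unit_vec n 0 = v"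
proof
  define w where "w i = v $ i - (if i = 0 then 1 else 0)" for i
  \<comment> \<open>In the degenerate case \<open>v $ 0 = 1\<close> the convention \<open>1 / 0 = 0\<close> makes \<open>H\<close> the identity.\<close>
  define c where "c = 1 / (1 - v $ 0)"
  define H where "H = mat n n (\<lambda>(i, j). (if i = j then 1 else 0) - c * w i * w j)"
  have vv: "(\<Sum>i<n. v $ i * v $ i) = 1"
    using unit v by (simp add: scalar_prod_def atLeast0LessThan)
  have "(\<Sum>i<n. w i * w i)
      = (\<Sum>i<n. v $ i * v $ i) + (\<Sum>i<n. if i = 0 then 1 - 2 * v $ 0 else 0)"
    unfolding sum.distrib[symmetric] by (intro sum.cong) (auto simp: w_def algebra_simps)
  also have "\<dots> = 2 - 2 * v $ 0" using n vv by simp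
  finally have ww: "(\<Sum>i<n. w i * w i) = 2 - 2 * v $ 0" .
  have cc: "c * c * (\<Sum>i<n. w i * w i) = 2 * c"
  proof (cases "v $ 0 = 1")
    case False
    hence "c * (1 - v $ 0) = 1" by (simp add: c_def)
    moreover have "c * c * (2 - 2 * v $ 0) = 2 * c * (c * (1 - v $ 0))" by (simp add: algebra_simps)
    ultimately show ?thesis unfolding ww by simp
  qed (simp add: c_def)
  show H: "H \<in> carrier_mat n n" by (simp add: H_def)
  show "transpose_mat H = H" by (rule eq_matI) (auto simp: H_def mult_ac)
  show "H * H = 1\<^sub>m n"
  proof (rule eq_matI)
    fix i j assume "i < dim_row (1\<^sub>m n)" "j < dim_col (1\<^sub>m n :: real mat)"
    hence ij: "i < n" "j < n" by auto
    have "(H * H) $$ (i, j) = (\<Sum>k<n. ((if i = k then 1 else 0) - c * w i * w k)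
        * ((if k = j then 1 else 0) - c * w k * w j))"
      using ij by (simp add: H_def scalar_prod_def atLeast0LessThan)
    also have "\<dots> = (\<Sum>k<n. if k = i then (if i = j then 1 else 0) - c * w i * w j else 0)
        - (\<Sum>k<n. if k = j then c * w i * w j else 0)
        + (\<Sum>k<n. c * c * (w k * w k) * (w i * w j))"
      unfolding sum_subtractf[symmetric] sum.distrib[symmetric]
      by (intro sum.cong) (auto simp: algebra_simps)
    also have "(\<Sum>k<n. c * c * (w k * w k) * (w i * w j)) = 2 * c * (w i * w j)"
      unfolding cc[symmetric] by (simp add: sum_distrib_left sum_distrib_right mult_ac)
    finally show "(H * H) $$ (i, j) = 1\<^sub>m n $$ (i, j)" using ij by simp
  qed (use H in auto)
  have diff: "c * (1 - v $ 0) * w i = w i" if "i < n" for i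
  proof (cases "v $ 0 = 1")
    case True
    hence "(\<Sum>i<n. w i * w i) = 0" using ww by simp
    hence "w i * w i = 0" using that by (subst (asm) sum_nonneg_eq_0_iff) auto
    thus ?thesis by simp
  qed (simp add: c_def)
  show "H *\<^sub>v unit_vec n 0 = v"
  proof (rule eq_vecI)
    fix i assume "i < dim_vec v"
    hence i: "i < n" using v by simp
    have "(H *\<^sub>v unit_vec n 0) $ i = H $$ (i, 0)"
      using i n H by simp
    also have "\<dots> = (if i = 0 then 1 else 0) + c * (1 - v $ 0) * w i"
      using i n by (simp add: H_def w_def algebra_simps)
    also have "\<dots> = v $ i" unfolding diff[OF i] by (simp add: w_def)
    finally show "(H *\<^sub>v unit_vec n 0) $ i = v $ i" .
  qed (use v H in auto)
qed

text \<open>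
  Deflation: after conjugation by a Householder reflection that sends an eigenvector for \<open>e\<close> to the
  first unit vector, symmetry clears the first row along with the first column. What remains is a
  symmetric matrix whose characteristic polynomial has lost the factor of \<open>e\<close>. The list of
  eigenvalues is prescribed so that its order can later be taken to be increasing.
\<close>

lemma real_spectral_theorem:
  fixes A :: "real mat"
  assumes "A \<in> carrier_mat n n" "transpose_mat A = A"
    and "char_poly A = (\<Prod>a\<leftarrow>es. [:- a, 1:])" and "length es = n"
  shows "\<exists>P\<in>carrier_mat n n. transpose_mat P * P = 1\<^sub>m n \<and> A * P = P * mat_diag n ((!) es)"
  using assms
proof (induction es arbitrary: A n)
  case Nil
  hence n: "n = 0" by simp
  show ?case using Nil.prems(1) unfolding n
    by (intro bexI[of _ "1\<^sub>m 0"] conjI eq_matI) (auto simp: mat_diag_def)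
next
  case (Cons e es)
  obtain m where n: "n = Suc m" using Cons.prems(4) by (metis length_Cons)
  note A = Cons.prems(1) and symA = Cons.prems(2) and cp = Cons.prems(3)
  have m: "length es = m" using Cons.prems(4) n by simp
  have "eigenvalue A e" unfolding eigenvalue_root_char_poly[OF A] cp by simp
  then obtain w where w: "w \<in> carrier_vec n" "w \<noteq> 0\<^sub>v n" "A *\<^sub>v w = e \<cdot>\<^sub>v w"
    using A unfolding eigenvalue_def eigenvector_def by auto
  have ww: "0 < w \<bullet> w" using conjugate_square_greater_0_vec[OF w(1)] w(2) by simp
  define v where "v = (1 / sqrt (w \<bullet> w)) \<cdot>\<^sub>v w"
  have v: "v \<in> carrier_vec n" using w by (simp add: v_def)
  have vv: "v \<bullet> v = 1" using w(1) ww by (simp add: v_def power2_eq_square[symmetric])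
  have Av: "A *\<^sub>v v = e \<cdot>\<^sub>v v"
    unfolding v_def mult_mat_vec[OF A w(1)] w(3) by (simp add: smult_smult_assoc mult.commute)
  obtain H where H: "H \<in> carrier_mat n n" and symH: "transpose_mat H = H"
    and HH: "H * H = 1\<^sub>m n" and He: "H *\<^sub>v unit_vec n 0 = v"
    using householder_reflection[OF v vv] n by auto
  define B where "B = H * A * H"
  have B: "B \<in> carrier_mat n n" using A H by (simp add: B_def)
  have symB: "transpose_mat B = B"
    using A H by (simp add: B_def transpose_mult[of _ n n _ n] symA symH assoc_mult_mat[of _ n n _ n _ n])
  have "A = H * B * H"
  proof -
    have "H * B * H = (H * H) * A * (H * H)"
      using A H by (simp add: B_def assoc_mult_mat[of _ n n _ n _ n])
    thus ?thesis using A HH by simp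
  qed
  hence sim: "similar_mat A B" using A B H HH by (intro similar_matI) auto
  have Be: "B *\<^sub>v unit_vec n 0 = e \<cdot>\<^sub>v unit_vec n 0"
  proof -
    have "B *\<^sub>v unit_vec n 0 = H *\<^sub>v (A *\<^sub>v (H *\<^sub>v unit_vec n 0))"
      using A H by (simp add: B_def assoc_mult_mat_vec[of _ n n _ n])
    also have "\<dots> = e \<cdot>\<^sub>v (H *\<^sub>v (H *\<^sub>v unit_vec n 0))"
      unfolding He Av mult_mat_vec[OF H v] ..
    also have "H *\<^sub>v (H *\<^sub>v unit_vec n 0) = (H * H) *\<^sub>v unit_vec n 0"
      using H by (simp add: assoc_mult_mat_vec[of _ n n _ n])
    finally show ?thesis by (simp add: HH)
  qed
  have col0: "B $$ (i, 0) = (if i = 0 then e else 0)" if "i < n" for i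
    using arg_cong[OF Be, of "\<lambda>u. u $ i"] that B n by simp
  have row0: "B $$ (0, i) = (if i = 0 then e else 0)" if "i < n" for i
    using arg_cong[OF symB, of "\<lambda>M. M $$ (0, i)"] col0[OF that] that B n by auto
  define C where "C = mat m m (\<lambda>(i, j). B $$ (Suc i, Suc j))"
  define E where "E = mat 1 1 (\<lambda>_. e)"
  have C: "C \<in> carrier_mat m m" and E: "E \<in> carrier_mat 1 1" by (simp_all add: C_def E_def)
  have BEC: "B = four_block_mat E (0\<^sub>m 1 m) (0\<^sub>m m 1) C"
    by (rule eq_matI) (use B n col0 row0 in \<open>auto simp: C_def E_def\<close>)
  have "symC": "transpose_mat C = C"
  proof (rule eq_matI)
    fix i j assume "i < dim_row C" "j < dim_col C"
    thus "transpose_mat C $$ (i, j) = C $$ (i, j)"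
      using arg_cong[OF symB, of "\<lambda>M. M $$ (Suc i, Suc j)"] B n by (auto simp: C_def)
  qed (use C in auto)
  have "char_poly E = [:- e, 1:]"
    by (simp add: char_poly_defs E_def det_single)
  hence "[:- e, 1:] * char_poly C = [:- e, 1:] * (\<Prod>a\<leftarrow>es. [:- a, 1:])"
    using char_poly_similar[OF sim] cp char_poly_four_block_zeros_col[OF E _ C, of "0\<^sub>m 1 m"]
    unfolding BEC by simp
  hence "char_poly C = (\<Prod>a\<leftarrow>es. [:- a, 1:])" by (metis mult_cancel_left pCons_eq_0_iff one_neq_zero)
  from Cons.IH[OF C symC this m] obtain R where R: "R \<in> carrier_mat m m"
    and RR: "transpose_mat R * R = 1\<^sub>m m" and CR: "C * R = R * mat_diag m ((!) es)" by auto
  define S where "S = four_block_mat (1\<^sub>m 1) (0\<^sub>m 1 m) (0\<^sub>m m 1) R"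
  have S: "S \<in> carrier_mat n n" using four_block_carrier_mat[of "1\<^sub>m 1" 1 1 R m m] R n by (simp add: S_def)
  have D: "mat_diag n ((!) (e # es)) = four_block_mat E (0\<^sub>m 1 m) (0\<^sub>m m 1) (mat_diag m ((!) es))"
    by (rule eq_matI) (use n in \<open>auto simp: E_def nth_Cons' mat_diag_def\<close>)
  have SS: "transpose_mat S * S = 1\<^sub>m n"
  proof -
    have "transpose_mat S = four_block_mat (1\<^sub>m 1) (0\<^sub>m 1 m) (0\<^sub>m m 1) (transpose_mat R)"
      unfolding S_def by (subst transpose_four_block_mat[of _ 1 1 _ m]) (use R in auto)
    hence "transpose_mat S * S = four_block_mat (1\<^sub>m 1) (0\<^sub>m 1 m) (0\<^sub>m m 1) (1\<^sub>m m)"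
      unfolding S_def by (simp, subst mult_four_block_mat[of _ 1 1 _ m _ m _ _ 1 _ m]) (use R RR in auto)
    thus ?thesis using n by auto
  qed
  have BS: "B * S = S * mat_diag n ((!) (e # es))"
    unfolding BEC S_def D
    by (subst (1 2) mult_four_block_mat[of _ 1 1 _ m _ m _ _ 1 _ m])
      (use R C E CR left_mult_zero_mat[OF mat_diag_dim, of 1 m "(!) es"] in auto)
  have P: "H * S \<in> carrier_mat n n" using H S by simp
  have "transpose_mat (H * S) * (H * S) = transpose_mat S * (H * H) * S"
    using H S by (simp add: transpose_mult[of _ n n _ n] symH assoc_mult_mat[of _ n n _ n _ n])
  hence 1: "transpose_mat (H * S) * (H * S) = 1\<^sub>m n" using HH SS S by simp
  have "A * (H * S) = (H * H) * A * H * S"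
    using A H S HH by (simp add: assoc_mult_mat[of _ n n _ n _ n])
  also have "\<dots> = H * (B * S)"
    using A H S by (simp add: B_def assoc_mult_mat[of _ n n _ n _ n])
  also have "\<dots> = H * S * mat_diag n ((!) (e # es))"
    unfolding BS using H S by (simp add: assoc_mult_mat[of _ n n _ n _ n])
  finally show ?case using P 1 by auto
qed

text \<open>
  Sums over coordinates replace matrices from here on: \<open>u l\<close> is the \<open>l\<close>-th coordinate functional in
  an orthonormal eigenbasis ordered by eigenvalue.
\<close>

lemma spectral_coordinates:
  fixes A :: "real mat"
  assumes A: "A \<in> carrier_mat n n" and sym: "transpose_mat A = A"
  shows "\<exists>u :: nat \<Rightarrow> nat \<Rightarrow> real. \<forall>x.
      (\<Sum>i<n. (x i)\<^sup>2) = (\<Sum>l<n. (\<Sum>i<n. u l i * x i)\<^sup>2)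
      \<and> (\<Sum>i<n. \<Sum>j<n. A $$ (i, j) * x i * x j)
        = (\<Sum>l<n. eigenvalue_list A ! l * (\<Sum>i<n. u l i * x i)\<^sup>2)"
proof -
  define es where "es = eigenvalue_list A"
  obtain P where P: "P \<in> carrier_mat n n" and PP: "transpose_mat P * P = 1\<^sub>m n"
    and AP: "A * P = P * mat_diag n ((!) es)"
    using real_spectral_theorem[OF A sym] char_poly_eigenvalue_list[OF A sym]
    unfolding es_def by blast
  have PT: "transpose_mat P \<in> carrier_mat n n" using P by simp
  have PP': "P * transpose_mat P = 1\<^sub>m n" using mat_mult_left_right_inverse[OF PT P PP] .
  let ?D = "mat_diag n ((!) es)"
  have main: "(\<Sum>i<n. (x i)\<^sup>2) = (\<Sum>l<n. (\<Sum>i<n. P $$ (i, l) * x i)\<^sup>2)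
    \<and> (\<Sum>i<n. \<Sum>j<n. A $$ (i, j) * x i * x j) = (\<Sum>l<n. es ! l * (\<Sum>i<n. P $$ (i, l) * x i)\<^sup>2)"
    for x :: "nat \<Rightarrow> real"
  proof -
    define v where "v = vec n x"
    define y where "y = transpose_mat P *\<^sub>v v"
    have v: "v \<in> carrier_vec n" and y: "y \<in> carrier_vec n" using P by (simp_all add: v_def y_def)
    have yl: "y $ l = (\<Sum>i<n. P $$ (i, l) * x i)" if "l < n" for l
      using that P by (simp add: y_def v_def scalar_prod_def atLeast0LessThan)
    have vPy: "v = P *\<^sub>v y" using P v PP' by (simp add: y_def assoc_mult_mat_vec[symmetric, of _ n n _ n])
    have yD: "y \<bullet> (z) = v \<bullet> (P *\<^sub>v z)" if "z \<in> carrier_vec n" for z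
      unfolding y_def using transpose_vec_mult_scalar[OF P that v] .
    have "v \<bullet> v = y \<bullet> y" using yD[OF y] vPy by simp
    moreover have "v \<bullet> v = (\<Sum>i<n. (x i)\<^sup>2)"
      by (simp add: v_def scalar_prod_def atLeast0LessThan power2_eq_square)
    moreover have "y \<bullet> y = (\<Sum>l<n. (\<Sum>i<n. P $$ (i, l) * x i)\<^sup>2)"
      using y by (simp add: scalar_prod_def atLeast0LessThan power2_eq_square yl)
    moreover have Dy: "?D *\<^sub>v y \<in> carrier_vec n" using mult_mat_vec_carrier[OF mat_diag_dim y] .
    have "A *\<^sub>v v = P *\<^sub>v (?D *\<^sub>v y)"
      unfolding vPy using A P y AP
      by (metis assoc_mult_mat_vec mat_diag_dim)
    hence "v \<bullet> (A *\<^sub>v v) = y \<bullet> (?D *\<^sub>v y)" using yD[OF Dy] by simp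
    moreover have "v \<bullet> (A *\<^sub>v v) = (\<Sum>i<n. \<Sum>j<n. A $$ (i, j) * x i * x j)"
      using A by (simp add: v_def scalar_prod_def atLeast0LessThan sum_distrib_left mult_ac)
    moreover have "y \<bullet> (?D *\<^sub>v y) = (\<Sum>l<n. es ! l * (\<Sum>i<n. P $$ (i, l) * x i)\<^sup>2)"
    proof -
      have Dyl: "(?D *\<^sub>v y) $ l = es ! l * y $ l" if "l < n" for l
      proof -
        have "(?D *\<^sub>v y) $ l = (\<Sum>k<n. (if l = k then es ! k else 0) * y $ k)"
          using that y by (simp add: scalar_prod_def atLeast0LessThan mat_diag_def)
        also have "\<dots> = (\<Sum>k<n. if k = l then es ! k * y $ k else 0)"
          by (intro sum.cong) auto
        finally have "(?D *\<^sub>v y) $ l = (\<Sum>k<n. if k = l then es ! k * y $ k else 0)" .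
        thus ?thesis using that by simp
      qed
      have "y \<bullet> (?D *\<^sub>v y) = (\<Sum>l<n. y $ l * (?D *\<^sub>v y) $ l)"
        unfolding scalar_prod_def carrier_vecD[OF Dy] atLeast0LessThan ..
      also have "\<dots> = (\<Sum>l<n. es ! l * (y $ l)\<^sup>2)"
        by (intro sum.cong refl) (simp only: Dyl lessThan_iff power2_eq_square mult_ac)
      finally show ?thesis by (simp add: yl)
    qed
    ultimately show ?thesis by simp
  qed
  show ?thesis unfolding es_def[symmetric] using main by (intro exI[of _ "\<lambda>l i. P $$ (i, l)"]) blast
qed

lemma common_kernel_nontrivial:
  fixes F :: "(nat \<Rightarrow> real) set"
  assumes "finite F" "card F < n"
  shows "\<exists>x :: nat \<Rightarrow> real. (\<exists>i<n. x i \<noteq> 0) \<and> (\<forall>f\<in>F. (\<Sum>i<n. f i * x i) = 0)"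
proof -
  obtain fs where fs: "set fs = F" "distinct fs" using finite_distinct_list[OF assms(1)] by auto
  have len: "length fs < n" using assms(2) fs distinct_card by metis
  \<comment> \<open>Fewer than \<open>n\<close> rows are in use, so the last row vanishes and \<open>M\<close> is singular.\<close>
  define M where "M = mat n n (\<lambda>(i, j). if i < length fs then (fs ! i) j else 0)"
  have M: "M \<in> carrier_mat n n" by (simp add: M_def)
  have "transpose_mat M *\<^sub>v unit_vec n (n - 1) = 0\<^sub>v n"
    by (rule eq_vecI) (use len in \<open>auto simp: M_def\<close>)
  moreover have "unit_vec n (n - 1) \<noteq> (0\<^sub>v n :: real vec)"
    using len by (metis diff_less gr_implies_not0 index_unit_vec(1) index_zero_vec(1) less_one
        linorder_neqE_nat zero_neq_one)
  ultimately have "det (transpose_mat M) = 0"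
    using M by (subst det_0_iff_vec_prod_zero[of _ n]) (auto intro!: exI[of _ "unit_vec n (n - 1)"])
  hence "det M = 0" using det_transpose[OF M] by simp
  then obtain v where v: "v \<in> carrier_vec n" "v \<noteq> 0\<^sub>v n" "M *\<^sub>v v = 0\<^sub>v n"
    using det_0_iff_vec_prod_zero[OF M] by auto
  show ?thesis
  proof (intro exI[of _ "($) v"] conjI ballI)
    show "\<exists>i<n. v $ i \<noteq> 0" using v(1,2) by (metis eq_vecI carrier_vecD index_zero_vec)
    fix f assume "f \<in> F"
    then obtain k where k: "k < length fs" "fs ! k = f" using fs by (metis in_set_conv_nth)
    thus "(\<Sum>i<n. f i * v $ i) = 0"
      using arg_cong[OF v(3), of "\<lambda>z. z $ k"] len v(1)
      by (simp add: M_def scalar_prod_def atLeast0LessThan)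
  qed
qed

section \<open>Eigenvalue bounds from constrained subspaces\<close>

text \<open>
  The constraints are of three kinds: entries in \<open>Z\<close> vanish, functionals in \<open>F\<close> vanish, and spectral
  coordinates in \<open>J\<close> vanish. As long as there are fewer than \<open>n\<close> of them, a nonzero vector remains.
  The number \<open>w l\<close> is the square of its \<open>l\<close>-th spectral coordinate. Both halves of the min-max
  principle come from this by the choice of \<open>J\<close>.
\<close>

lemma constrained_spectral_weights:
  fixes A :: "real mat" and F :: "(nat \<Rightarrow> real) set"
  assumes A: "A \<in> carrier_mat n n" "transpose_mat A = A"
    and fin: "finite Z" "finite F" "finite J" and few: "card Z + card F + card J < n"
  obtains x w :: "nat \<Rightarrow> real" where "\<forall>u\<in>Z. x u = 0" "\<forall>f\<in>F. (\<Sum>u<n. f u * x u) = 0"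
    "\<forall>l\<in>J. w l = 0" "\<forall>l. 0 \<le> w l" "0 < (\<Sum>l<n. w l)"
    "(\<Sum>u<n. (x u)\<^sup>2) = (\<Sum>l<n. w l)"
    "(\<Sum>u<n. \<Sum>v<n. A $$ (u, v) * x u * x v) = (\<Sum>l<n. eigenvalue_list A ! l * w l)"
proof -
  obtain u :: "nat \<Rightarrow> nat \<Rightarrow> real" where u: "\<forall>x.
      (\<Sum>i<n. (x i)\<^sup>2) = (\<Sum>l<n. (\<Sum>i<n. u l i * x i)\<^sup>2)
      \<and> (\<Sum>i<n. \<Sum>j<n. A $$ (i, j) * x i * x j)
        = (\<Sum>l<n. eigenvalue_list A ! l * (\<Sum>i<n. u l i * x i)\<^sup>2)"
    using spectral_coordinates[OF A] by blast
  define G where "G = (\<lambda>z v. if v = z then 1 else 0) ` Z \<union> F \<union> u ` J"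
  have "card G \<le> card ((\<lambda>z v. if v = z then 1 else 0 :: real) ` Z) + card F + card (u ` J)"
    unfolding G_def by (meson add_le_mono card_Un_le le_refl le_trans)
  also have "\<dots> \<le> card Z + card F + card J"
    using fin by (intro add_mono card_image_le) auto
  finally have "card G < n" using few by simp
  moreover have "finite G" using fin by (simp add: G_def)
  ultimately obtain x where x: "\<exists>i<n. x i \<noteq> 0" and ker: "\<forall>f\<in>G. (\<Sum>i<n. f i * x i) = 0"
    using common_kernel_nontrivial[of G n] by blast
  define x' where "x' v = (if v < n then x v else 0)" for v
  have kerZ: "x' z = 0" if "z \<in> Z" for z
  proof -
    have "(\<Sum>v<n. (if v = z then 1 else 0) * x v) = 0" using ker that by (simp add: G_def)
    moreover have "(\<Sum>v<n. (if v = z then 1 else 0) * x v) = (\<Sum>v<n. if v = z then x v else 0)"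
      by (intro sum.cong) auto
    ultimately show ?thesis by (simp add: x'_def split: if_splits)
  qed
  have pos: "0 < (\<Sum>v<n. (x' v)\<^sup>2)" using x by (auto simp: x'_def intro!: sum_pos2)
  show ?thesis
  proof (rule that[of x' "\<lambda>l. (\<Sum>i<n. u l i * x' i)\<^sup>2"])
    show "\<forall>f\<in>F. (\<Sum>v<n. f v * x' v) = 0" "\<forall>l\<in>J. (\<Sum>i<n. u l i * x' i)\<^sup>2 = 0"
      using ker by (auto simp: G_def x'_def)
    show "0 < (\<Sum>l<n. (\<Sum>i<n. u l i * x' i)\<^sup>2)" using pos spec[OF u, of x'] by simp
  qed (use kerZ spec[OF u, of x'] in auto)
qed

text \<open>
  A subspace of codimension less than \<open>i\<close> meets the span of the first \<open>i\<close> eigenvectors, on which the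
  form is at most the \<open>i\<close>-th eigenvalue times the squared norm.
\<close>

lemma nth_eigenvalue_ge:
  fixes A :: "real mat" and F :: "(nat \<Rightarrow> real) set"
  assumes A: "A \<in> carrier_mat n n" "transpose_mat A = A"
    and fin: "finite Z" "finite F" and few: "card Z + card F < i" "i \<le> n"
    and form: "\<And>x. \<forall>u\<in>Z. x u = 0 \<Longrightarrow> \<forall>f\<in>F. (\<Sum>u<n. f u * x u) = 0 \<Longrightarrow>
      c * (\<Sum>u<n. (x u)\<^sup>2) \<le> (\<Sum>u<n. \<Sum>v<n. A $$ (u, v) * x u * x v)"
  shows "c \<le> nth_eigenvalue A i"
proof -
  let ?es = "eigenvalue_list A"
  obtain x w :: "nat \<Rightarrow> real" where xw: "\<forall>u\<in>Z. x u = 0" "\<forall>f\<in>F. (\<Sum>u<n. f u * x u) = 0"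
    "\<forall>l\<in>{i..<n}. w l = 0" "\<forall>l. 0 \<le> w l" "0 < (\<Sum>l<n. w l)"
    "(\<Sum>u<n. (x u)\<^sup>2) = (\<Sum>l<n. w l)"
    "(\<Sum>u<n. \<Sum>v<n. A $$ (u, v) * x u * x v) = (\<Sum>l<n. ?es ! l * w l)"
    by (rule constrained_spectral_weights[OF A fin, of "{i..<n}"]) (use few in auto)
  have "c * (\<Sum>l<n. w l) \<le> (\<Sum>l<n. ?es ! l * w l)" using form[OF xw(1,2)] xw(6,7) by simp
  also have "\<dots> \<le> (\<Sum>l<n. ?es ! (i - 1) * w l)"
  proof (rule sum_mono)
    fix l assume l: "l \<in> {..<n}"
    show "?es ! l * w l \<le> ?es ! (i - 1) * w l"
    proof (cases "i \<le> l")
      case False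
      thus ?thesis using few xw(4) char_poly_eigenvalue_list(2,3)[OF A]
        by (intro mult_right_mono sorted_nth_mono) auto
    qed (use l xw(3) in auto)
  qed
  also have "\<dots> = ?es ! (i - 1) * (\<Sum>l<n. w l)" by (simp add: sum_distrib_left)
  finally show ?thesis using xw(5) by (simp add: nth_eigenvalue_def)
qed

text \<open>
  A subspace of codimension at most \<open>n - i\<close> meets the span of the eigenvectors from the \<open>i\<close>-th on.
\<close>

lemma nth_eigenvalue_le:
  fixes A :: "real mat" and F :: "(nat \<Rightarrow> real) set"
  assumes A: "A \<in> carrier_mat n n" "transpose_mat A = A"
    and fin: "finite Z" "finite F" and few: "card Z + card F + i \<le> n" "1 \<le> i"
    and form: "\<And>x. \<forall>u\<in>Z. x u = 0 \<Longrightarrow> \<forall>f\<in>F. (\<Sum>u<n. f u * x u) = 0 \<Longrightarrow>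
      (\<Sum>u<n. \<Sum>v<n. A $$ (u, v) * x u * x v) \<le> c * (\<Sum>u<n. (x u)\<^sup>2)"
  shows "nth_eigenvalue A i \<le> c"
proof -
  let ?es = "eigenvalue_list A"
  obtain x w :: "nat \<Rightarrow> real" where xw: "\<forall>u\<in>Z. x u = 0" "\<forall>f\<in>F. (\<Sum>u<n. f u * x u) = 0"
    "\<forall>l\<in>{..<i - 1}. w l = 0" "\<forall>l. 0 \<le> w l" "0 < (\<Sum>l<n. w l)"
    "(\<Sum>u<n. (x u)\<^sup>2) = (\<Sum>l<n. w l)"
    "(\<Sum>u<n. \<Sum>v<n. A $$ (u, v) * x u * x v) = (\<Sum>l<n. ?es ! l * w l)"
    by (rule constrained_spectral_weights[OF A fin, of "{..<i - 1}"]) (use few in auto)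
  have "?es ! (i - 1) * (\<Sum>l<n. w l) = (\<Sum>l<n. ?es ! (i - 1) * w l)"
    by (simp add: sum_distrib_left)
  also have "\<dots> \<le> (\<Sum>l<n. ?es ! l * w l)"
  proof (rule sum_mono)
    fix l assume l: "l \<in> {..<n}"
    show "?es ! (i - 1) * w l \<le> ?es ! l * w l"
    proof (cases "l < i - 1")
      case False
      thus ?thesis using l few xw(4) char_poly_eigenvalue_list(2,3)[OF A]
        by (intro mult_right_mono sorted_nth_mono) auto
    qed (use xw(3) in auto)
  qed
  also have "\<dots> \<le> c * (\<Sum>l<n. w l)" using form[OF xw(1,2)] xw(6,7) by simp
  finally show ?thesis using xw(5) by (simp add: nth_eigenvalue_def)
qed

section \<open>The quadratic form of a threshold graph\<close>

text \<open>
  Positions start at \<open>0\<close> and vertices at \<open>1\<close>, whence the shift.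
\<close>

definition ones_edges :: "nat set \<Rightarrow> nat set set" where
  "ones_edges S = {{u + 1, v + 1} | u v. u < v \<and> v \<in> S}"

definition edge_form :: "nat set \<Rightarrow> (nat \<Rightarrow> real) \<Rightarrow> real" where
  "edge_form S x = (\<Sum>v\<in>S. \<Sum>u<v. (x u + x v)\<^sup>2)"

lemma vertex_degree_ones_edges:
  assumes "finite S"
  shows "vertex_degree (ones_edges S) (v + 1) = (if v \<in> S then v else 0) + card {t \<in> S. v < t}"
proof -
  define L where "L = (\<lambda>u. {u + 1, v + 1}) ` (if v \<in> S then {..<v} else {})"
  define U where "U = (\<lambda>t. {v + 1, t + 1}) ` {t \<in> S. v < t}"
  have "{e \<in> ones_edges S. v + 1 \<in> e} = L \<union> U"
  proof (intro equalityI subsetI)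
    fix e assume "e \<in> {e \<in> ones_edges S. v + 1 \<in> e}"
    then obtain u t where e: "e = {u + 1, t + 1}" "u < t" "t \<in> S" "v + 1 \<in> e"
      unfolding ones_edges_def by blast
    hence "v = u \<or> v = t" by simp
    thus "e \<in> L \<union> U" using e by (auto simp: L_def U_def)
  next
    fix e assume "e \<in> L \<union> U"
    then consider u where "v \<in> S" "u < v" "e = {u + 1, v + 1}"
      | t where "t \<in> S" "v < t" "e = {v + 1, t + 1}"
      unfolding L_def U_def by (auto split: if_splits)
    thus "e \<in> {e \<in> ones_edges S. v + 1 \<in> e}"
      unfolding ones_edges_def by cases blast+
  qed
  moreover have "L \<inter> U = {}"
    unfolding L_def U_def by (fastforce simp: doubleton_eq_iff split: if_splits)
  moreover have "card L = (if v \<in> S then v else 0)"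
    unfolding L_def by (subst card_image) (auto simp: inj_on_def doubleton_eq_iff)
  moreover have "card U = card {t \<in> S. v < t}"
    unfolding U_def by (rule card_image) (simp add: inj_on_def doubleton_eq_iff)
  moreover have "finite L" "finite U" using assms by (auto simp: L_def U_def)
  ultimately show ?thesis by (simp add: vertex_degree_def card_Un_disjoint)
qed

text \<open>
  Each edge contributes its two endpoints to the degrees and twice its product of entries to the
  adjacency part, which together make a square.
\<close>

lemma signless_laplacian_form:
  assumes S: "S \<subseteq> {..<n}"
  shows "(\<Sum>u<n. \<Sum>v<n. signless_laplacian n (ones_edges S) $$ (u, v) * x u * x v) = edge_form S x"
proof -
  \<comment> \<open>\<open>a\<close> is the adjacency relation with each edge directed from its earlier to its later end.\<close>
  define a where "a u v = (if u < v \<and> v \<in> S then 1 else 0 :: real)" for u v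
  have fin: "finite S" using S finite_subset by blast
  have deg: "real (vertex_degree (ones_edges S) (u + 1)) = (\<Sum>t<n. a u t + a t u)" if "u < n" for u
  proof -
    have "(\<Sum>t<n. a u t) = real (card {t \<in> S. u < t})"
      unfolding a_def using S
      by (subst sum.inter_filter[symmetric]) (auto intro!: arg_cong[of _ _ card])
    moreover have "(\<Sum>t<n. a t u) = real (if u \<in> S then u else 0)"
    proof -
      have "{t \<in> {..<n}. t < u} = {..<u}" using that by auto
      thus ?thesis unfolding a_def by (subst sum.inter_filter[symmetric]) auto
    qed
    ultimately show ?thesis unfolding vertex_degree_ones_edges[OF fin] sum.distrib by simp
  qed
  have entry: "signless_laplacian n (ones_edges S) $$ (u, v)
      = (if u = v then \<Sum>t<n. a u t + a t u else 0) + (a u v + a v u)" if "u < n" "v < n" for u v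
  proof -
    have "(if {u + 1, v + 1} \<in> ones_edges S then 1 else 0) = a u v + a v u"
      by (auto simp: ones_edges_def a_def doubleton_eq_iff)
    thus ?thesis using that deg[of u]
      by (auto simp add: signless_laplacian_def degree_matrix_def adjacency_matrix_def mat_diag_def)
  qed
  have "(\<Sum>u<n. \<Sum>v<n. signless_laplacian n (ones_edges S) $$ (u, v) * x u * x v)
      = (\<Sum>u<n. \<Sum>v<n. (if v = u then (\<Sum>t<n. a u t + a t u) * (x u)\<^sup>2 else 0)
          + (a u v + a v u) * (x u * x v))"
    by (intro sum.cong) (auto simp: entry algebra_simps power2_eq_square)
  also have "\<dots> = (\<Sum>u<n. \<Sum>v<n. (a u v + a v u) * (x u)\<^sup>2)
      + (\<Sum>u<n. \<Sum>v<n. (a u v + a v u) * (x u * x v))"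
    by (simp add: sum.distrib sum_distrib_right[symmetric])
  also have "\<dots> = (\<Sum>u<n. \<Sum>v<n. a u v * ((x u)\<^sup>2 + x u * x v))
      + (\<Sum>u<n. \<Sum>v<n. a v u * ((x u)\<^sup>2 + x u * x v))"
    unfolding sum.distrib[symmetric] by (intro sum.cong) (auto simp: algebra_simps)
  also have "(\<Sum>u<n. \<Sum>v<n. a v u * ((x u)\<^sup>2 + x u * x v)) = (\<Sum>u<n. \<Sum>v<n. a u v * ((x v)\<^sup>2 + x v * x u))"
    by (rule sum.swap)
  also have "(\<Sum>u<n. \<Sum>v<n. a u v * ((x u)\<^sup>2 + x u * x v)) + \<dots> = (\<Sum>u<n. \<Sum>v<n. a u v * (x u + x v)\<^sup>2)"
    unfolding sum.distrib[symmetric] by (intro sum.cong) (auto simp: algebra_simps power2_eq_square)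
  also have "\<dots> = (\<Sum>v<n. \<Sum>u<n. a u v * (x u + x v)\<^sup>2)" by (rule sum.swap)
  also have "\<dots> = (\<Sum>v<n. if v \<in> S then \<Sum>u<v. (x u + x v)\<^sup>2 else 0)"
  proof (intro sum.cong refl)
    fix v assume v: "v \<in> {..<n}"
    have "(\<Sum>u<n. a u v * (x u + x v)\<^sup>2) = (\<Sum>u<n. if u < v \<and> v \<in> S then (x u + x v)\<^sup>2 else 0)"
      by (intro sum.cong) (auto simp: a_def)
    also have "\<dots> = (if v \<in> S then \<Sum>u<v. (x u + x v)\<^sup>2 else 0)"
    proof -
      have "{u \<in> {..<n}. u < v} = {..<v}" using v by auto
      thus ?thesis by (simp add: sum.inter_filter[symmetric])
    qed
    finally show "(\<Sum>u<n. a u v * (x u + x v)\<^sup>2) = (if v \<in> S then \<Sum>u<v. (x u + x v)\<^sup>2 else 0)" .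
  qed
  also have "\<dots> = edge_form S x"
  proof -
    have "{v \<in> {..<n}. v \<in> S} = S" using S by auto
    thus ?thesis unfolding edge_form_def by (subst sum.inter_filter[symmetric]) simp_all
  qed
  finally show ?thesis .
qed

lemma edge_form_mono: "finite S \<Longrightarrow> T \<subseteq> S \<Longrightarrow> edge_form T x \<le> edge_form S x"
  unfolding edge_form_def by (intro sum_mono2) (auto intro!: sum_nonneg)

lemma edge_form_nonneg: "0 \<le> edge_form S x"
  unfolding edge_form_def by (intro sum_nonneg) auto

lemma sum_square_shift:
  fixes x :: "nat \<Rightarrow> real"
  shows "(\<Sum>u\<in>A. (x u + y)\<^sup>2)
    = (\<Sum>u\<in>A. (x u)\<^sup>2) + 2 * y * (\<Sum>u\<in>A. x u) + real (card A) * y\<^sup>2"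
proof -
  have "(\<Sum>u\<in>A. (x u + y)\<^sup>2) = (\<Sum>u\<in>A. (x u)\<^sup>2 + 2 * y * x u + y\<^sup>2)"
    by (intro sum.cong refl) (simp add: power2_sum)
  thus ?thesis by (simp add: sum.distrib sum_distrib_left)
qed

text \<open>
  The signless Laplacian of a complete graph on \<open>m\<close> vertices is \<open>m - 2\<close> times the identity plus the
  all-ones matrix.
\<close>

lemma clique_form:
  fixes x :: "nat \<Rightarrow> real"
  assumes "finite T"
  shows "(\<Sum>t\<in>T. \<Sum>u\<in>{u \<in> T. u < t}. (x u + x t)\<^sup>2)
    = (real (card T) - 2) * (\<Sum>t\<in>T. (x t)\<^sup>2) + (\<Sum>t\<in>T. x t)\<^sup>2"
  using assms
proof (induction T rule: finite_linorder_max_induct)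
  case (insert b A)
  have b: "b \<notin> A" using insert by auto
  have split: "(\<Sum>t\<in>insert b A. \<Sum>u\<in>{u \<in> insert b A. u < t}. (x u + x t)\<^sup>2)
      = (\<Sum>u\<in>A. (x u + x b)\<^sup>2) + (\<Sum>t\<in>A. \<Sum>u\<in>{u \<in> A. u < t}. (x u + x t)\<^sup>2)"
    unfolding sum.insert[OF insert(1) b] using insert(2)
    by (intro arg_cong2[where f = "(+)"] sum.cong) auto
  show ?case unfolding split insert.IH sum_square_shift[of x "x b" A] using insert(1) b
    by (simp add: algebra_simps power2_eq_square)
qed simp

text \<open>
  Only the edges before \<open>c\<close> and those with later end in \<open>T\<close> and earlier end before \<open>c\<close> or in \<open>T\<close> are
  kept. The latter form the join of the first \<open>c\<close> vertices with the clique \<open>T\<close>, so that their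
  contribution has a closed form. The lower bounds on eigenvalues by degrees start from this estimate.
\<close>

lemma edge_form_ge:
  fixes x :: "nat \<Rightarrow> real" and c :: nat
  assumes S: "finite S"
  defines "T \<equiv> {t \<in> S. c \<le> t}"
  shows "edge_form {v \<in> S. v < c} x + real (card T) * (\<Sum>u<c. (x u)\<^sup>2)
      + 2 * (\<Sum>u<c. x u) * (\<Sum>t\<in>T. x t) + (real c + real (card T) - 2) * (\<Sum>t\<in>T. (x t)\<^sup>2)
      + (\<Sum>t\<in>T. x t)\<^sup>2 \<le> edge_form S x"
proof -
  have T: "finite T" using S by (simp add: T_def)
  have "(\<Sum>t\<in>T. \<Sum>u<c. (x u + x t)\<^sup>2)
      = (\<Sum>t\<in>T. (\<Sum>u<c. (x u)\<^sup>2) + 2 * (\<Sum>u<c. x u) * x t + real c * (x t)\<^sup>2)"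
    by (intro sum.cong) (auto simp: sum_square_shift)
  also have "\<dots> = real (card T) * (\<Sum>u<c. (x u)\<^sup>2) + 2 * (\<Sum>u<c. x u) * (\<Sum>t\<in>T. x t)
      + real c * (\<Sum>t\<in>T. (x t)\<^sup>2)"
    by (simp add: sum.distrib sum_distrib_left)
  finally have join: "(\<Sum>t\<in>T. \<Sum>u<c. (x u + x t)\<^sup>2) = \<dots>" .
  have "(\<Sum>t\<in>T. \<Sum>u<c. (x u + x t)\<^sup>2) + (\<Sum>t\<in>T. \<Sum>u\<in>{u \<in> T. u < t}. (x u + x t)\<^sup>2)
      = (\<Sum>t\<in>T. \<Sum>u\<in>{..<c} \<union> {u \<in> T. u < t}. (x u + x t)\<^sup>2)"
    unfolding sum.distrib[symmetric] using T
    by (intro sum.cong refl sum.union_disjoint[symmetric]) (auto simp: T_def)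
  also have "\<dots> \<le> edge_form T x"
    unfolding edge_form_def by (intro sum_mono sum_mono2) (auto simp: T_def)
  finally have "(\<Sum>t\<in>T. \<Sum>u<c. (x u + x t)\<^sup>2) + (\<Sum>t\<in>T. \<Sum>u\<in>{u \<in> T. u < t}. (x u + x t)\<^sup>2)
      \<le> edge_form T x" .
  moreover have "edge_form {v \<in> S. v < c} x + edge_form T x = edge_form S x"
  proof -
    have "{v \<in> S. v < c} \<union> T = S" by (auto simp: T_def)
    moreover have "edge_form ({v \<in> S. v < c} \<union> T) x = edge_form {v \<in> S. v < c} x + edge_form T x"
      unfolding edge_form_def using S by (intro sum.union_disjoint) (auto simp: T_def)
    ultimately show ?thesis by simp
  qed
  ultimately show ?thesis unfolding join clique_form[OF T] by (simp add: algebra_simps)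
qed

section \<open>Eigenvalues against degrees\<close>

context
  fixes n :: nat and S :: "nat set"
  assumes S: "S \<subseteq> {..<n}"
begin

abbreviation (input) "deg v \<equiv> real (vertex_degree (ones_edges S) (v + 1))"
abbreviation (input) "eig i \<equiv> nth_eigenvalue (signless_laplacian n (ones_edges S)) i"

lemma finite_ones: "finite S"
  using S finite_subset by blast

lemmas deg_eq = vertex_degree_ones_edges[OF finite_ones, unfolded Suc_eq_plus1[symmetric]]

lemma eig_ge:
  assumes "finite Z" "finite F" "card Z + card F < i" "i \<le> n"
    and "\<And>x. \<forall>u\<in>Z. x u = 0 \<Longrightarrow> \<forall>f\<in>F. (\<Sum>u<n. f u * x u) = 0 \<Longrightarrow>
      c * (\<Sum>u<n. (x u)\<^sup>2) \<le> edge_form S x"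
  shows "c \<le> eig i"
  by (rule nth_eigenvalue_ge[OF signless_laplacian_symmetric assms(1-4)])
    (simp only: signless_laplacian_form[OF S] assms(5))

lemma eig_le:
  assumes "finite Z" "finite F" "card Z + card F + i \<le> n" "1 \<le> i"
    and "\<And>x. \<forall>u\<in>Z. x u = 0 \<Longrightarrow> \<forall>f\<in>F. (\<Sum>u<n. f u * x u) = 0 \<Longrightarrow>
      edge_form S x \<le> c * (\<Sum>u<n. (x u)\<^sup>2)"
  shows "eig i \<le> c"
  by (rule nth_eigenvalue_le[OF signless_laplacian_symmetric assms(1-4)])
    (simp only: signless_laplacian_form[OF S] assms(5))

lemma eig_nonneg: "1 \<le> i \<Longrightarrow> i \<le> n \<Longrightarrow> 0 \<le> eig i"
  by (rule eig_ge[of "{}" "{}"]) (auto simp: edge_form_nonneg)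

lemma sum_squares_split:
  fixes x :: "nat \<Rightarrow> real"
  assumes "c \<le> n" and zero: "\<And>u. c \<le> u \<Longrightarrow> u < n \<Longrightarrow> u \<notin> S \<Longrightarrow> x u = 0"
  shows "(\<Sum>u<n. (x u)\<^sup>2) = (\<Sum>u<c. (x u)\<^sup>2) + (\<Sum>t\<in>{t \<in> S. c \<le> t}. (x t)\<^sup>2)"
proof -
  have "(\<Sum>u<n. (x u)\<^sup>2) = (\<Sum>u\<in>{..<c} \<union> {t \<in> S. c \<le> t}. (x u)\<^sup>2)"
  proof (intro sum.mono_neutral_right)
    show "\<forall>u\<in>{..<n} - ({..<c} \<union> {t \<in> S. c \<le> t}). (x u)\<^sup>2 = 0" by (auto simp: not_less intro!: zero)
  qed (use assms S in auto)
  also have "\<dots> = (\<Sum>u<c. (x u)\<^sup>2) + (\<Sum>t\<in>{t \<in> S. c \<le> t}. (x t)\<^sup>2)"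
    using finite_ones by (intro sum.union_disjoint) auto
  finally show ?thesis .
qed

lemma sum_prefix_functional:
  fixes x :: "nat \<Rightarrow> real"
  assumes "c \<le> n"
  shows "(\<Sum>u<n. (if u < c then 1 else 0) * x u) = (\<Sum>u<c. x u)"
proof -
  have "(\<Sum>u<n. (if u < c then 1 else 0) * x u) = (\<Sum>u<n. if u < c then x u else 0)"
    by (intro sum.cong) auto
  moreover have "{u \<in> {..<n}. u < c} = {..<c}" using assms by auto
  ultimately show ?thesis by (simp add: sum.inter_filter[symmetric])
qed

lemma card_ones_after:
  assumes "v < n"
  shows "card {t \<in> S. v < t} + v < n"
proof -
  have "card {t \<in> S. v < t} \<le> card {v<..<n}" using S by (intro card_mono) auto
  thus ?thesis using assms by simp
qed

lemma card_ones_from: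
  assumes "v \<in> S"
  shows "card {t \<in> S. v \<le> t} = card {t \<in> S. v < t} + 1"
proof -
  have "{t \<in> S. v \<le> t} = insert v {t \<in> S. v < t}" using assms by auto
  thus ?thesis using finite_ones by simp
qed

text \<open>
  On the clique \<open>{t \<in> S. v \<le> t}\<close> the form is at least \<open>d - 1\<close> times the squared norm, since each of
  its vertices has at least \<open>v\<close> further neighbours.
\<close>

lemma eig_ge_dominating:
  assumes v: "v \<in> S"
  shows "deg v - 1 \<le> eig (n - card {t \<in> S. v < t})"
proof (rule eig_ge)
  let ?T = "{t \<in> S. v \<le> t}"
  have vn: "v < n" using v S by auto
  have "card ({..<n} - ?T) = n - card ?T"
    using S by (subst card_Diff_subset) (auto intro: finite_subset)
  thus "card ({..<n} - ?T) + card {} < n - card {t \<in> S. v < t}"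
    using card_ones_from[OF v] card_ones_after[OF vn] by simp
  fix x :: "nat \<Rightarrow> real" assume x: "\<forall>u\<in>{..<n} - ?T. x u = 0"
  hence low: "x u = 0" if "u < v" for u using that vn by auto
  have deg: "deg v - 1 = real v + real (card ?T) - 2" using v by (simp add: deg_eq card_ones_from)
  have sq: "(\<Sum>u<n. (x u)\<^sup>2) = (\<Sum>t\<in>?T. (x t)\<^sup>2)"
    using sum_squares_split[of v x] vn x low by simp
  have "edge_form {t \<in> S. t < v} x + (real v + real (card ?T) - 2) * (\<Sum>t\<in>?T. (x t)\<^sup>2)
      + (\<Sum>t\<in>?T. x t)\<^sup>2 \<le> edge_form S x"
    using edge_form_ge[OF finite_ones, of v x] low by simp
  thus "(deg v - 1) * (\<Sum>u<n. (x u)\<^sup>2) \<le> edge_form S x"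
    unfolding deg sq
    using edge_form_nonneg[of "{t \<in> S. t < v}" x] zero_le_power2[of "\<Sum>t\<in>?T. x t"] by linarith
qed (auto simp: finite_ones)

text \<open>
  The zeros from \<open>w\<close> on are pairwise not adjacent, so on vectors supported there the form is the sum
  of degrees times squares, and \<open>w\<close> has the largest of these degrees.
\<close>

lemma eig_le_isolated:
  assumes w: "w < n" "w \<notin> S"
  shows "eig (card {u. w \<le> u \<and> u < n \<and> u \<notin> S}) \<le> deg w"
proof (rule eig_le)
  let ?Z = "{u. w \<le> u \<and> u < n \<and> u \<notin> S}"
  have sub: "?Z \<subseteq> {..<n}" by auto
  have "card ({..<n} - ?Z) = n - card ?Z"
    using sub by (subst card_Diff_subset) (auto intro: finite_subset)
  moreover have "card ?Z \<le> n" using card_mono[OF _ sub] by simp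
  ultimately show "card ({..<n} - ?Z) + card {} + card ?Z \<le> n" by simp
  have "card {w} \<le> card ?Z" using w sub by (intro card_mono finite_subset[OF sub]) auto
  thus "1 \<le> card ?Z" by simp
  fix x :: "nat \<Rightarrow> real" assume x: "\<forall>u\<in>{..<n} - ?Z. x u = 0"
  have "(\<Sum>u<v. (x u + x v)\<^sup>2) \<le> (if w < v then \<Sum>u<n. (x u)\<^sup>2 else 0)" if v: "v \<in> S" for v
  proof -
    have vn: "v < n" using v S by auto
    hence "x v = 0" using x v by auto
    moreover have "x u = 0" if "u < v" "v \<le> w" for u using that vn x by auto
    moreover have "(\<Sum>u<v. (x u)\<^sup>2) \<le> (\<Sum>u<n. (x u)\<^sup>2)" using vn by (intro sum_mono2) auto
    ultimately show ?thesis by auto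
  qed
  hence "edge_form S x \<le> (\<Sum>v\<in>S. if w < v then \<Sum>u<n. (x u)\<^sup>2 else 0)"
    unfolding edge_form_def by (intro sum_mono)
  also have "\<dots> = deg w * (\<Sum>u<n. (x u)\<^sup>2)"
    using finite_ones w by (simp add: sum.inter_filter[symmetric] deg_eq)
  finally show "edge_form S x \<le> deg w * (\<Sum>u<n. (x u)\<^sup>2)" .
qed auto

text \<open>
  The first \<open>v + 1\<close> vertices contribute at most as much as a complete graph, whose second largest
  eigenvalue is \<open>v - 1\<close>; the condition on the sum excludes its largest one. Every later one \<open>t\<close> has
  entry \<open>0\<close>, so its edges contribute at most the squared norm.
\<close>

lemma eig_le_dominating:
  assumes v: "v \<in> S" "1 \<le> v"
  shows "eig (n - card {t \<in> S. v < t} - 1) \<le> deg v - 1"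
proof (rule eig_le)
  let ?T = "{t \<in> S. v < t}" and ?f = "\<lambda>u. if u < v + 1 then 1 else 0 :: real"
  have vn: "v < n" using v S by auto
  show "card ?T + card {?f} + (n - card ?T - 1) \<le> n" "1 \<le> n - card ?T - 1"
    using card_ones_after[OF vn] v(2) by auto
  fix x :: "nat \<Rightarrow> real" assume x: "\<forall>u\<in>?T. x u = 0" and f: "\<forall>f\<in>{?f}. (\<Sum>u<n. f u * x u) = 0"
  have sum0: "(\<Sum>u<v + 1. x u) = 0" using f sum_prefix_functional[of "v + 1" x] vn by simp
  have "edge_form S x = edge_form ({t \<in> S. t \<le> v} \<union> ?T) x"
    by (intro arg_cong2[where f = edge_form]) auto
  also have "\<dots> = edge_form {t \<in> S. t \<le> v} x + edge_form ?T x"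
    unfolding edge_form_def using finite_ones by (intro sum.union_disjoint) auto
  also have "edge_form {t \<in> S. t \<le> v} x \<le> (real v - 1) * (\<Sum>u<n. (x u)\<^sup>2)"
  proof -
    have "edge_form {t \<in> S. t \<le> v} x \<le> edge_form {..<v + 1} x"
      by (rule edge_form_mono) auto
    also have "\<dots> = (\<Sum>t<v + 1. \<Sum>u\<in>{u \<in> {..<v + 1}. u < t}. (x u + x t)\<^sup>2)"
      unfolding edge_form_def by (intro sum.cong) auto
    also have "\<dots> = (real v - 1) * (\<Sum>u<v + 1. (x u)\<^sup>2)"
      unfolding clique_form[OF finite_lessThan] sum0 by simp
    also have "\<dots> \<le> (real v - 1) * (\<Sum>u<n. (x u)\<^sup>2)"
      using v vn by (intro mult_left_mono sum_mono2) auto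
    finally show ?thesis .
  qed
  also have "edge_form ?T x \<le> (\<Sum>t\<in>?T. \<Sum>u<n. (x u)\<^sup>2)"
    unfolding edge_form_def using x S by (intro sum_mono) (auto intro!: sum_mono2)
  finally show "edge_form S x \<le> (deg v - 1) * (\<Sum>u<n. (x u)\<^sup>2)"
    using v by (simp add: deg_eq algebra_simps)
qed (auto simp: finite_ones)

text \<open>
  With sum \<open>0\<close> on the first \<open>w + 1\<close> vertices, the mixed terms in the join with the later ones vanish.
  Each of the first \<open>w + 1\<close> entries then has weight at least the number \<open>d\<close> of later ones, and each
  later one has weight at least \<open>w + 1 + d - 2\<close>, which suffices as \<open>w \<ge> 1\<close>.
\<close>

lemma eig_ge_isolated:
  assumes w: "w < n" "w \<notin> S" "1 \<le> w"
  shows "deg w \<le> eig (card {u. w \<le> u \<and> u < n \<and> u \<notin> S} + 1)"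
proof (rule eig_ge)
  let ?Z = "{u. w < u \<and> u < n \<and> u \<notin> S}" and ?f = "\<lambda>u. if u < w + 1 then 1 else 0 :: real"
    and ?T = "{t \<in> S. w + 1 \<le> t}"
  have "{u. w \<le> u \<and> u < n \<and> u \<notin> S} = insert w ?Z" using w by auto
  hence card: "card {u. w \<le> u \<and> u < n \<and> u \<notin> S} = card ?Z + 1" by simp
  thus "card ?Z + card {?f} < card {u. w \<le> u \<and> u < n \<and> u \<notin> S} + 1" by simp
  have "card ?Z \<le> card {w<..<n}" by (intro card_mono) auto
  thus "card {u. w \<le> u \<and> u < n \<and> u \<notin> S} + 1 \<le> n" using card w by simp
  fix x :: "nat \<Rightarrow> real" assume x: "\<forall>u\<in>?Z. x u = 0" and f: "\<forall>f\<in>{?f}. (\<Sum>u<n. f u * x u) = 0"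
  have sum0: "(\<Sum>u<w + 1. x u) = 0" using f sum_prefix_functional[of "w + 1" x] w by simp
  have sq: "(\<Sum>u<n. (x u)\<^sup>2) = (\<Sum>u<w + 1. (x u)\<^sup>2) + (\<Sum>t\<in>?T. (x t)\<^sup>2)"
    by (rule sum_squares_split) (use w x in auto)
  have deg: "deg w = real (card ?T)" using w by (simp add: deg_eq Suc_le_eq)
  have "real (card ?T) * (\<Sum>t\<in>?T. (x t)\<^sup>2) \<le> (real (w + 1) + real (card ?T) - 2) * (\<Sum>t\<in>?T. (x t)\<^sup>2)"
    using w by (intro mult_right_mono sum_nonneg) auto
  moreover have "edge_form {t \<in> S. t < w + 1} x + real (card ?T) * (\<Sum>u<w + 1. (x u)\<^sup>2)
      + (real (w + 1) + real (card ?T) - 2) * (\<Sum>t\<in>?T. (x t)\<^sup>2) + (\<Sum>t\<in>?T. x t)\<^sup>2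
      \<le> edge_form S x"
    using edge_form_ge[OF finite_ones, of "w + 1" x] unfolding sum0 by simp
  ultimately show "deg w * (\<Sum>u<n. (x u)\<^sup>2) \<le> edge_form S x"
    unfolding sq deg distrib_left
    using edge_form_nonneg[of "{t \<in> S. t < w + 1}" x] zero_le_power2[of "\<Sum>t\<in>?T. x t"] by linarith
qed auto

text \<open>
  The subspace consists of the vectors that have a constant value \<open>y\<close> on the initial clique, an
  arbitrary value on each later one, and value \<open>0\<close> on each zero except the first, \<open>p\<close>. There the value
  \<open>x p\<close> is determined by the sum of the entries at later ones through \<open>s = (p - 1) * x p\<close>. With
  \<open>x p = 0\<close> instead the bound can fail. For given \<open>s\<close> this value of \<open>x p\<close> maximises the excess of the
  estimate \<open>edge_form_ge\<close> over the bound, and that excess becomes \<open>p * (p - 1) * (y + x p)\<^sup>2\<close>.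
\<close>

lemma eig_ge_initial_clique:
  assumes p: "2 \<le> p" "p < n" "{..<p} \<subseteq> S" "p \<notin> S"
  shows "real (p - 1) + real (card {t \<in> S. p < t}) \<le> eig (n - card {t \<in> S. p < t})"
proof (rule eig_ge)
  let ?T = "{t \<in> S. p + 1 \<le> t}" and ?Z = "{u. p < u \<and> u < n \<and> u \<notin> S}"
  define g where "g u v = (if v = u then 1 else 0) - (if v = 0 then 1 else 0 :: real)" for u v :: nat
  define h where "h v = (if v \<in> ?T then 1 else 0) - (if v = p then real (p - 1) else 0)" for v
  \<comment> \<open>\<open>g u\<close> expresses that entries \<open>u\<close> and \<open>0\<close> agree, and \<open>h\<close> that the later ones sum to \<open>(p - 1) * x p\<close>.\<close>
  define F where "F = insert h (g ` {1..<p})"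
  have T: "?T = {t \<in> S. p < t}" by auto
  have "{p<..<n} = ?Z \<union> {t \<in> S. p < t}" using S by auto
  moreover have "card (?Z \<union> {t \<in> S. p < t}) = card ?Z + card {t \<in> S. p < t}"
    using finite_ones by (intro card_Un_disjoint) auto
  ultimately have "card {p<..<n} = card ?Z + card {t \<in> S. p < t}" by simp
  hence cards: "card ?Z + card {t \<in> S. p < t} + p + 1 = n" using p by simp
  have "card F \<le> 1 + card {1..<p}"
    unfolding F_def using card_image_le[of "{1..<p}" g] by (simp add: card_insert_if)
  thus "card ?Z + card F < n - card {t \<in> S. p < t}" using cards p by simp
  show "n - card {t \<in> S. p < t} \<le> n" "finite ?Z" "finite F" by (simp_all add: F_def)
  fix x :: "nat \<Rightarrow> real" assume x: "\<forall>u\<in>?Z. x u = 0" and F: "\<forall>f\<in>F. (\<Sum>u<n. f u * x u) = 0"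
  define y where "y = x 0"
  define s where "s = (\<Sum>t\<in>?T. x t)"
  have y: "x u = y" if "u < p" for u
  proof (cases "u = 0")
    case False
    hence "(\<Sum>v<n. g u v * x v) = 0" using F that by (simp add: F_def)
    moreover have "(\<Sum>v<n. g u v * x v) = (\<Sum>v<n. (if v = u then x v else 0) - (if v = 0 then x v else 0))"
      by (intro sum.cong) (auto simp: g_def)
    ultimately show ?thesis using that p by (simp add: sum_subtractf y_def)
  qed (simp add: y_def)
  have s: "s = real (p - 1) * x p"
  proof -
    have "(\<Sum>v<n. h v * x v) = 0" using F by (simp add: F_def)
    moreover have "(\<Sum>v<n. h v * x v)
        = (\<Sum>v<n. (if v \<in> ?T then x v else 0) - (if v = p then real (p - 1) * x v else 0))"
      by (intro sum.cong) (auto simp: h_def algebra_simps)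
    moreover have "{v \<in> {..<n}. v \<in> ?T} = ?T" using S by auto
    hence "(\<Sum>v<n. if v \<in> ?T then x v else 0) = s"
      unfolding s_def by (subst sum.inter_filter[symmetric]) simp_all
    ultimately show ?thesis using p by (simp add: sum_subtractf)
  qed
  have sq: "(\<Sum>u<n. (x u)\<^sup>2) = (\<Sum>u<p + 1. (x u)\<^sup>2) + (\<Sum>t\<in>?T. (x t)\<^sup>2)"
    by (rule sum_squares_split) (use p x in auto)
  have squares: "(\<Sum>u<p + 1. (x u)\<^sup>2) = real p * y\<^sup>2 + (x p)\<^sup>2" using y by simp
  have total: "(\<Sum>u<p + 1. x u) = real p * y + x p" using y by simp
  have low: "{t \<in> S. t < p + 1} = {..<p}"
  proof (intro equalityI subsetI)
    fix t assume t: "t \<in> {t \<in> S. t < p + 1}"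
    hence "t \<noteq> p" using p(4) by blast
    thus "t \<in> {..<p}" using t by simp
  qed (use p(3) in auto)
  have "edge_form {t \<in> S. t < p + 1} x = (\<Sum>t<p. \<Sum>u\<in>{u \<in> {..<p}. u < t}. (x u + x t)\<^sup>2)"
    unfolding edge_form_def low by (intro sum.cong refl) auto
  also have "\<dots> = 2 * real p * (real p - 1) * y\<^sup>2"
    unfolding clique_form[OF finite_lessThan] using y by (simp add: algebra_simps power2_eq_square)
  finally have clique: "edge_form {t \<in> S. t < p + 1} x = 2 * real p * (real p - 1) * y\<^sup>2" .
  define m where "m = real (card ?T)"
  define R where "R = (\<Sum>t\<in>?T. (x t)\<^sup>2)"
  define P where "P = real p"
  have P: "real (p - 1) = P - 1" "P \<ge> 2" using p by (auto simp: P_def of_nat_diff)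
  have "edge_form S x \<ge> 2 * P * (P - 1) * y\<^sup>2 + m * (P * y\<^sup>2 + (x p)\<^sup>2)
      + 2 * (P * y + x p) * s + (P + 1 + m - 2) * R + s\<^sup>2"
    using edge_form_ge[OF finite_ones, of "p + 1" x]
    unfolding clique squares total s_def[symmetric] m_def[symmetric] R_def[symmetric] P_def
    by simp
  moreover have "2 * P * (P - 1) * y\<^sup>2 + m * (P * y\<^sup>2 + (x p)\<^sup>2)
      + 2 * (P * y + x p) * s + (P + 1 + m - 2) * R + s\<^sup>2
      - (P - 1 + m) * (P * y\<^sup>2 + (x p)\<^sup>2 + R) = P * (P - 1) * (y + x p)\<^sup>2"
    unfolding s P(1) by (simp add: algebra_simps power2_eq_square)
  moreover have "0 \<le> P * (P - 1) * (y + x p)\<^sup>2" using P by simp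
  ultimately show "(real (p - 1) + real (card {t \<in> S. p < t})) * (\<Sum>u<n. (x u)\<^sup>2) \<le> edge_form S x"
    unfolding sq squares R_def[symmetric] P(1) P_def[symmetric] T[symmetric] m_def[symmetric] by linarith
qed

end

section \<open>The degree sequence\<close>

context
  fixes n :: nat and S :: "nat set"
  assumes S: "S \<subseteq> {..<n}"
begin

abbreviation (input) "degr v \<equiv> vertex_degree (ones_edges S) (v + 1)"

lemma degr_eq: "degr v = (if v \<in> S then v else 0) + card {t \<in> S. v < t}"
  by (rule vertex_degree_ones_edges) (use S finite_subset in blast)

lemma card_ones_after_le:
  assumes "v \<le> w"
  shows "card {t \<in> S. v < t} \<le> card {t \<in> S. w < t} + card {t \<in> S. v < t \<and> t \<le> w}"
proof -
  have "{t \<in> S. v < t} = {t \<in> S. w < t} \<union> {t \<in> S. v < t \<and> t \<le> w}" using assms by auto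
  thus ?thesis by (metis card_Un_le)
qed

lemma card_ones_between: "card {t \<in> S. v < t \<and> t \<le> w} \<le> w - v"
proof -
  have "card {t \<in> S. v < t \<and> t \<le> w} \<le> card {v<..w}" by (intro card_mono) auto
  thus ?thesis by simp
qed

lemma card_ones_after_antimono: "v \<le> w \<Longrightarrow> card {t \<in> S. w < t} \<le> card {t \<in> S. v < t}"
  using S by (intro card_mono) (auto intro: finite_subset[of _ "{..<n}"])

lemma degr_dominating_mono:
  assumes "v \<in> S" "w \<in> S" "v \<le> w"
  shows "degr v \<le> degr w"
  using assms card_ones_after_le[of v w] card_ones_between[of v w] unfolding degr_eq by simp

lemma degr_isolated_antimono:
  assumes "v \<notin> S" "w \<notin> S" "v \<le> w"
  shows "degr w \<le> degr v"
  using assms card_ones_after_antimono[of v w] unfolding degr_eq by simp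

text \<open>
  The digit at position \<open>0\<close> does not influence the graph, so with different initial digits a zero and
  a one may have the same degree, as in a single edge with digits \<open>0\<close> and \<open>1\<close>. When the digits at
  positions \<open>0\<close> and \<open>1\<close> agree, the cases \<open>w = 0\<close> and \<open>v = 0\<close> gain one from position \<open>1\<close>.
\<close>

lemma degr_isolated_less_dominating:
  assumes v: "v \<in> S" and w: "w \<notin> S" and start: "0 \<in> S \<longleftrightarrow> 1 \<in> S"
  shows "degr w < degr v"
proof (cases "w < v")
  case True
  have "card {t \<in> S. w < t \<and> t \<le> v} < v"
  proof (cases "w = 0")
    case True
    have "{t \<in> S. w < t \<and> t \<le> v} \<subseteq> {1<..v}"
    proof
      fix t assume t: "t \<in> {t \<in> S. w < t \<and> t \<le> v}"
      hence "t \<noteq> 1" using start w \<open>w = 0\<close> by auto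
      thus "t \<in> {1<..v}" using t by auto
    qed
    hence "card {t \<in> S. w < t \<and> t \<le> v} \<le> v - 1"
      by (metis card_greaterThanAtMost card_mono finite_greaterThanAtMost)
    thus ?thesis using \<open>w < v\<close> by simp
  qed (use \<open>w < v\<close> card_ones_between[of w v] in linarith)
  thus ?thesis using True v w card_ones_after_le[of w v] unfolding degr_eq by simp
next
  case False
  hence vw: "v < w" using v w by (metis linorder_neqE_nat)
  show ?thesis
  proof (cases "v = 0")
    case True
    have "1 \<in> S" using start v True by simp
    moreover have "w \<noteq> 1" using calculation w by auto
    ultimately have one: "1 \<in> S" "1 < w" using vw True by auto
    have "{t \<in> S. w < t} \<subset> {t \<in> S. v < t}" using True one by auto
    hence "card {t \<in> S. w < t} < card {t \<in> S. v < t}"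
      using S by (intro psubset_card_mono) (auto intro: finite_subset[of _ "{..<n}"])
    thus ?thesis using v w unfolding degr_eq by simp
  qed (use vw v w card_ones_after_antimono[of v w] in \<open>simp add: degr_eq[unfolded Suc_eq_plus1[symmetric]]\<close>)
qed

lemma card_greater_nth:
  fixes xs :: "nat list"
  assumes "sorted_wrt (<) xs" "j < length xs"
  shows "card {y \<in> set xs. xs ! j < y} = length xs - Suc j"
proof -
  have "{y \<in> set xs. xs ! j < y} = set (drop (Suc j) xs)"
  proof (intro equalityI subsetI)
    fix y assume "y \<in> {y \<in> set xs. xs ! j < y}"
    then obtain k where k: "k < length xs" "y = xs ! k" "xs ! j < xs ! k" by (auto simp: in_set_conv_nth)
    hence "j < k" using assms by (metis less_asym linorder_neqE_nat less_irrefl sorted_wrt_nth_less)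
    hence "y = drop (Suc j) xs ! (k - Suc j)" using k by simp
    moreover have "k - Suc j < length (drop (Suc j) xs)" using k \<open>j < k\<close> by simp
    ultimately show "y \<in> set (drop (Suc j) xs)" by (metis nth_mem)
  next
    fix y assume "y \<in> set (drop (Suc j) xs)"
    then obtain k where "k < length xs - Suc j" "y = xs ! (Suc j + k)" by (auto simp: in_set_conv_nth)
    thus "y \<in> {y \<in> set xs. xs ! j < y}" using sorted_wrt_nth_less[OF assms(1), of j "Suc j + k"] by auto
  qed
  moreover have "distinct xs" using assms(1) strict_sorted_iff by blast
  ultimately show ?thesis by (simp add: distinct_card)
qed

definition zeros_list :: "nat list" where "zeros_list = filter (\<lambda>v. v \<notin> S) [0..<n]"
definition ones_list :: "nat list" where "ones_list = filter (\<lambda>v. v \<in> S) [0..<n]"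

lemma sorted_lists: "sorted_wrt (<) zeros_list" "sorted_wrt (<) ones_list"
  by (simp_all add: zeros_list_def ones_list_def sorted_wrt_filter)

lemma set_lists: "set zeros_list = {..<n} - S" "set ones_list = S"
  using S by (auto simp: zeros_list_def ones_list_def)

lemma length_lists: "length zeros_list = n - card S" "length ones_list = card S"
proof -
  have "distinct zeros_list" "distinct ones_list" using sorted_lists strict_sorted_iff by blast+
  thus "length zeros_list = n - card S" "length ones_list = card S"
    using distinct_card[of zeros_list] distinct_card[of ones_list] set_lists S
    by (simp_all add: card_Diff_subset finite_subset)
qed

lemma degree_list_ones_edges:
  assumes start: "0 \<in> S \<longleftrightarrow> 1 \<in> S"
  shows "degree_list n (ones_edges S) = map degr (rev zeros_list @ ones_list)"
  unfolding degree_list_def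
proof (rule properties_for_sort)
  have "mset (rev zeros_list @ ones_list) = mset [0..<n]"
  proof -
    have "mset (filter (\<lambda>v. v \<notin> S) vs) + mset (filter (\<lambda>v. v \<in> S) vs) = mset vs" for vs
      by (induction vs) auto
    thus ?thesis by (simp only: zeros_list_def ones_list_def mset_append mset_rev)
  qed
  from arg_cong[OF this, of "image_mset degr"]
  have "mset (map degr (rev zeros_list @ ones_list)) = mset (map degr [0..<n])"
    by (simp only: mset_map)
  also have "map degr [0..<n] = map (vertex_degree (ones_edges S)) [1..<n + 1]"
  proof -
    have "[1..<n + 1] = map Suc [0..<n]" unfolding map_Suc_upt by simp
    show ?thesis unfolding \<open>[1..<n + 1] = _\<close> map_map by simp
  qed
  finally show "mset (map degr (rev zeros_list @ ones_list))
      = mset (map (vertex_degree (ones_edges S)) [1..<n + 1])" .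
  have "sorted_wrt (\<lambda>v w. degr w \<le> degr v) zeros_list"
    using sorted_lists(1) set_lists(1) degr_isolated_antimono
    by (intro sorted_wrt_mono_rel[OF _ sorted_lists(1)]) auto
  moreover have "sorted_wrt (\<lambda>v w. degr v \<le> degr w) ones_list"
    using set_lists(2) degr_dominating_mono
    by (intro sorted_wrt_mono_rel[OF _ sorted_lists(2)]) auto
  moreover have "degr w \<le> degr v" if "w \<in> set zeros_list" "v \<in> set ones_list" for v w
    using degr_isolated_less_dominating[OF _ _ start, of v w] that set_lists by auto
  ultimately show "sorted (map degr (rev zeros_list @ ones_list))"
    by (auto simp: sorted_wrt_append sorted_map sorted_wrt_rev)
qed

text \<open>
  The largest \<open>card S\<close> degrees belong to the ones, the last one having the largest degree.
\<close>

lemma nth_degree_dominating: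
  assumes start: "0 \<in> S \<longleftrightarrow> 1 \<in> S" and i: "n - card S < i" "i \<le> n"
  shows "\<exists>v\<in>S. card {t \<in> S. v < t} = n - i \<and> nth_degree n (ones_edges S) i = degr v"
proof -
  define j where "j = i - 1 - (n - card S)"
  have cS: "card S \<le> n" using card_mono[OF _ S] by simp
  have j: "j < length ones_list" "length zeros_list + j = i - 1"
    using i cS by (auto simp: j_def length_lists)
  have mem: "ones_list ! j \<in> S" using nth_mem[OF j(1)] by (simp only: set_lists)
  have "card {t \<in> S. ones_list ! j < t} = n - i"
    using card_greater_nth[OF sorted_lists(2) j(1)] i cS
    by (simp add: set_lists length_lists j_def)
  moreover have "nth_degree n (ones_edges S) i = degr (ones_list ! j)"
  proof -
    have "i - 1 < length (rev zeros_list @ ones_list)" using j by simp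
    moreover have "(rev zeros_list @ ones_list) ! (i - 1) = ones_list ! j"
      using nth_append_length_plus[of "rev zeros_list" ones_list j] j(2) by simp
    ultimately show ?thesis
      unfolding nth_degree_def degree_list_ones_edges[OF start] by (simp only: nth_map)
  qed
  ultimately show ?thesis using mem by blast
qed

text \<open>
  The smallest degrees belong to the zeros, the last zero having the smallest degree.
\<close>

lemma nth_degree_isolated:
  assumes start: "0 \<in> S \<longleftrightarrow> 1 \<in> S" and i: "1 \<le> i" "i \<le> n - card S"
  shows "\<exists>w<n. w \<notin> S \<and> card {u. w \<le> u \<and> u < n \<and> u \<notin> S} = i
    \<and> nth_degree n (ones_edges S) i = degr w"
proof -
  define j where "j = length zeros_list - i"
  have j: "j < length zeros_list" "length zeros_list - Suc j = i - 1"
    using i by (auto simp: j_def length_lists)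
  define w where "w = zeros_list ! j"
  have mem: "u \<in> set zeros_list \<longleftrightarrow> u < n \<and> u \<notin> S" for u by (simp add: set_lists)
  have "w \<in> set zeros_list" using nth_mem[OF j(1)] by (simp add: w_def)
  hence w: "w < n" "w \<notin> S" using mem by simp_all
  have "{u. w \<le> u \<and> u < n \<and> u \<notin> S} = insert w {u \<in> set zeros_list. w < u}"
    unfolding mem using w by (auto simp: le_less)
  moreover have "card {u \<in> set zeros_list. w < u} = i - 1"
    using card_greater_nth[OF sorted_lists(1) j(1)] j(2) by (simp only: w_def)
  ultimately have "card {u. w \<le> u \<and> u < n \<and> u \<notin> S} = i" using i(1) by simp
  moreover have "nth_degree n (ones_edges S) i = degr w"
  proof -
    have "i - 1 < length zeros_list" using i by (simp add: length_lists)
    moreover have "length zeros_list - Suc (i - 1) = j" using i by (simp add: j_def)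
    ultimately show ?thesis
      unfolding nth_degree_def degree_list_ones_edges[OF start] w_def
      by (simp add: nth_append rev_nth)
  qed
  ultimately show ?thesis using w i by auto
qed

end

section \<open>Interleaved chains\<close>

lemma successively_interleave:
  fixes f g :: "nat \<Rightarrow> real"
  assumes "\<And>i. a \<le> i \<Longrightarrow> i < b \<Longrightarrow> g i \<le> f i"
    and "\<And>i. a < i \<Longrightarrow> i < b \<Longrightarrow> f (i - 1) \<le> g i"
  shows "successively (\<ge>) (concat (map (\<lambda>i. [f i, g i]) (rev [a..<b])))"
  using assms
proof (induction b)
  case (Suc b)
  show ?case
  proof (cases "a \<le> b")
    case True
    have IH: "successively (\<ge>) (concat (map (\<lambda>i. [f i, g i]) (rev [a..<b])))"
      using Suc by simp
    have gf: "g b \<le> f b" using Suc.prems(1)[of b] True by simp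
    show ?thesis
    proof (cases "a = b")
      case False
      then obtain c where c: "b = Suc c" "a \<le> c" using True by (cases b) auto
      have "f c \<le> g b" using Suc.prems(2)[of b] c by simp
      thus ?thesis using IH gf c by (simp add: successively_Cons)
    qed (use gf in simp)
  qed simp
qed simp

lemma interleave_ends:
  assumes "a < b"
  shows "hd (concat (map (\<lambda>i. [f i, g i]) (rev [a..<b]))) = f (b - 1)"
    and "last (concat (map (\<lambda>i. [f i, g i]) (rev [a..<b]))) = g a"
    and "concat (map (\<lambda>i. [f i, g i]) (rev [a..<b])) \<noteq> []"
proof -
  obtain c where c: "b = Suc c" "a \<le> c" using assms by (cases b) auto
  thus "hd (concat (map (\<lambda>i. [f i, g i]) (rev [a..<b]))) = f (b - 1)"
    and "concat (map (\<lambda>i. [f i, g i]) (rev [a..<b])) \<noteq> []" by auto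
  show "last (concat (map (\<lambda>i. [f i, g i]) (rev [a..<b]))) = g a"
    using upt_conv_Cons[OF assms] by simp
qed

section \<open>From binary sequences to sets of positions\<close>

definition one_positions :: "nat \<Rightarrow> (nat \<Rightarrow> nat) \<Rightarrow> (nat \<Rightarrow> nat) \<Rightarrow> nat set" where
  "one_positions r b q = (\<Union>k\<in>{k \<in> {1..r}. b k = 1}. {block_end q (k - 1)..<block_end q k})"

lemma block_end_mono: "i \<le> j \<Longrightarrow> block_end q i \<le> block_end q j"
  unfolding block_end_def by (intro sum_mono2) auto

lemma block_end_Suc: "block_end q (Suc k) = block_end q k + q (Suc k)"
  by (simp add: block_end_def)

lemma block_end_0: "block_end q 0 = 0"
  by (simp add: block_end_def)

lemma one_positions_subset: "one_positions r b q \<subseteq> {..<block_end q r}"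
proof
  fix v assume "v \<in> one_positions r b q"
  then obtain k where "k \<le> r" "v < block_end q k" by (auto simp: one_positions_def)
  thus "v \<in> {..<block_end q r}" using block_end_mono[of k r q] by simp
qed

lemma threshold_edges_one_positions: "threshold_edges r b q = ones_edges (one_positions r b q)"
proof (intro equalityI subsetI)
  fix e assume "e \<in> threshold_edges r b q"
  then obtain i j k where e: "e = {i, j}" "1 \<le> i" "i < j" "k \<in> {1..r}"
    "block_end q (k - 1) < j" "j \<le> block_end q k" "b k = 1"
    unfolding threshold_edges_def by blast
  hence "j - 1 \<in> one_positions r b q" unfolding one_positions_def by auto
  moreover have "e = {(i - 1) + 1, (j - 1) + 1}" "i - 1 < j - 1" using e by auto
  ultimately show "e \<in> ones_edges (one_positions r b q)" unfolding ones_edges_def by blast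
next
  fix e assume "e \<in> ones_edges (one_positions r b q)"
  then obtain u v where e: "e = {u + 1, v + 1}" "u < v" "v \<in> one_positions r b q"
    unfolding ones_edges_def by blast
  from e(3) obtain k where k: "k \<in> {1..r}" "b k = 1" "block_end q (k - 1) \<le> v" "v < block_end q k"
    unfolding one_positions_def by auto
  have "v + 1 \<le> block_end q r" using k block_end_mono[of k r q] by simp
  moreover have "\<exists>k\<in>{1..r}. block_end q (k - 1) < v + 1 \<and> v + 1 \<le> block_end q k \<and> b k = 1"
    using k by (intro bexI[of _ k]) auto
  ultimately show "e \<in> threshold_edges r b q"
    unfolding threshold_edges_def using e(1,2) by (intro CollectI exI[of _ "u + 1"] exI[of _ "v + 1"]) simp
qed

lemma card_one_positions:
  assumes "\<forall>k\<in>{1..r}. b k \<in> {0, 1}"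
  shows "card (one_positions r b q) = (\<Sum>k=1..r. b k * q k)"
  using assms
proof (induction r)
  case (Suc r)
  have split: "one_positions (Suc r) b q = one_positions r b q
      \<union> (if b (Suc r) = 1 then {block_end q r..<block_end q (Suc r)} else {})"
    unfolding one_positions_def by (auto simp: le_Suc_eq)
  have "one_positions r b q \<inter> {block_end q r..<block_end q (Suc r)} = {}"
    using one_positions_subset[of r b q] by auto
  moreover have "finite (one_positions r b q)" by (auto simp: one_positions_def)
  moreover have "b (Suc r) \<in> {0, 1}" using Suc.prems by simp
  ultimately show ?case unfolding split using Suc by (auto simp: card_Un_disjoint block_end_Suc)
qed (simp add: one_positions_def)

lemma one_positions_first_block:
  assumes "1 \<le> r" "v < q 1"
  shows "v \<in> one_positions r b q \<longleftrightarrow> b 1 = 1"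
proof
  assume "v \<in> one_positions r b q"
  then obtain k where k: "1 \<le> k" "b k = 1" "block_end q (k - 1) \<le> v" by (auto simp: one_positions_def)
  have "k = 1"
  proof (rule ccontr)
    assume "k \<noteq> 1"
    hence "block_end q 1 \<le> block_end q (k - 1)" using k(1) by (intro block_end_mono) simp
    thus False using k(3) assms(2) block_end_Suc[of q 0] by (simp add: block_end_0)
  qed
  thus "b 1 = 1" using k by simp
next
  assume "b 1 = 1"
  thus "v \<in> one_positions r b q"
    unfolding one_positions_def using assms block_end_Suc[of q 0]
    by (intro UN_I[of 1]) (auto simp: block_end_0)
qed

lemma one_positions_second_block:
  assumes "0 < q 1" "b 2 = 0" "0 < q 2"
  shows "q 1 \<notin> one_positions r b q"
proof
  assume "q 1 \<in> one_positions r b q"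
  then obtain k where k: "1 \<le> k" "b k = 1" "block_end q (k - 1) \<le> q 1" "q 1 < block_end q k"
    by (auto simp: one_positions_def)
  have ends: "block_end q 1 = q 1" "block_end q 2 = q 1 + q 2"
    using block_end_Suc[of q 0] block_end_Suc[of q 1] by (simp_all add: block_end_0 numeral_2_eq_2)
  have "k \<noteq> 1" "k \<noteq> 2" using k ends assms by auto
  hence "block_end q 2 \<le> block_end q (k - 1)" using k(1) by (intro block_end_mono) simp
  thus False using k(3) ends assms by simp
qed

section \<open>The interlacing chain\<close>

text \<open>
  The facts \<open>A\<close> to \<open>D\<close> are the four families of inequalities between eigenvalues and degrees, and \<open>M\<close>
  joins the two halves of the chain. If there are no zeros the chain ends with \<open>d 1 - 1 \<ge> 0\<close> instead
  of the smallest eigenvalue.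
\<close>

theorem theorem13:
  fixes r n kbar :: nat and b q :: "nat \<Rightarrow> nat" and E :: "nat set set"
    and d lam :: "nat \<Rightarrow> real"
  assumes "binary_sequence r b q" and "alternating r b" and "q 1 \<ge> 2"
    and "n = block_end q r"
    and "E = threshold_edges r b q"
    and "d = (\<lambda>i. real (nth_degree n E i))"
    and "lam = nth_eigenvalue (signless_laplacian n E)"
    and "kbar = (\<Sum>i=1..r. b i * q i)"
  shows "successively (\<ge>)
           (concat (map (\<lambda>i. [lam i, d i - 1]) (rev [n + 1 - kbar..<n + 1]))
            @ concat (map (\<lambda>i. [d i, lam i]) (rev [1..<n - kbar + 1]))
            @ [0])
         \<and> (b 1 = 1 \<and> kbar > q 1 \<longrightarrow> lam (n - kbar + q 1) \<ge> d (n - kbar + q 1))"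
proof -
  define S where "S = one_positions r b q"
  have r: "1 \<le> r" and bq: "\<forall>k\<in>{1..r}. b k \<in> {0, 1} \<and> 0 < q k"
    using assms(1) by (auto simp: binary_sequence_def)
  have S: "S \<subseteq> {..<n}" using one_positions_subset by (simp add: S_def assms(4))
  have E: "E = ones_edges S" by (simp add: S_def assms(5) threshold_edges_one_positions)
  have k: "kbar = card S" using card_one_positions[of r b q] bq by (simp add: S_def assms(8))
  have finS: "finite S" using S finite_subset by blast
  have kn: "kbar \<le> n" using card_mono[OF _ S] k by simp
  have q1n: "q 1 \<le> n" using block_end_mono[of 1 r q] r block_end_Suc[of q 0]
    by (simp add: assms(4) block_end_0)
  have first: "v \<in> S \<longleftrightarrow> b 1 = 1" if "v < q 1" for v
    unfolding S_def using one_positions_first_block[OF r, of v q b] that by simp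
  have start: "0 \<in> S \<longleftrightarrow> 1 \<in> S" using first[of 0] first[of 1] assms(3) by simp
  have d: "d i = real (nth_degree n (ones_edges S) i)" for i by (simp add: assms(6) E)
  have lam: "lam i = nth_eigenvalue (signless_laplacian n (ones_edges S)) i" for i
    by (simp add: assms(7) E)
  note upper = nth_degree_dominating[OF S start] and lower = nth_degree_isolated[OF S start]

  have A: "d i - 1 \<le> lam i" if i: "n - kbar < i" "i \<le> n" for i
  proof -
    obtain v where "v \<in> S" "card {t \<in> S. v < t} = n - i"
      "nth_degree n (ones_edges S) i = vertex_degree (ones_edges S) (v + 1)"
      using upper[of i] i k by auto
    thus ?thesis using eig_ge_dominating[OF S, of v] i by (simp add: d lam)
  qed
  have B: "lam (i - 1) \<le> d i - 1" if i: "n - kbar + 1 < i" "i \<le> n" for i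
  proof -
    obtain v where v: "v \<in> S" "card {t \<in> S. v < t} = n - i"
      "nth_degree n (ones_edges S) i = vertex_degree (ones_edges S) (v + 1)"
      using upper[of i] i k by auto
    have "v \<noteq> 0"
    proof
      \<comment> \<open>At \<open>v = 0\<close> all ones are counted, which makes \<open>i\<close> the smallest index of a one.\<close>
      assume "v = 0"
      hence "S = insert 0 {t \<in> S. v < t}" using v(1) by auto
      hence "kbar = Suc (n - i)"
        using finS v(2) k \<open>v = 0\<close> by (metis (no_types, lifting) card_insert_disjoint finite_insert
             less_irrefl mem_Collect_eq)
      thus False using i kn by simp
    qed
    thus ?thesis using eig_le_dominating[OF S v(1)] v i by (simp add: d lam)
  qed
  have C: "lam i \<le> d i" if i: "1 \<le> i" "i \<le> n - kbar" for i
  proof -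
    obtain w where "w < n" "w \<notin> S" "card {u. w \<le> u \<and> u < n \<and> u \<notin> S} = i"
      "nth_degree n (ones_edges S) i = vertex_degree (ones_edges S) (w + 1)"
      using lower[of i] i k by auto
    thus ?thesis using eig_le_isolated[OF S, of w] by (simp add: d lam)
  qed
  have D: "d (i - 1) \<le> lam i" if i: "1 < i" "i \<le> n - kbar" for i
  proof -
    have "1 \<le> i - 1" "i - 1 \<le> n - card S" using i k by auto
    then obtain w where w: "w < n" "w \<notin> S" "card {u. w \<le> u \<and> u < n \<and> u \<notin> S} = i - 1"
      "nth_degree n (ones_edges S) (i - 1) = vertex_degree (ones_edges S) (w + 1)"
      using lower[of "i - 1"] by blast
    have "w \<noteq> 0"
    proof
      assume "w = 0"
      hence "{u. w \<le> u \<and> u < n \<and> u \<notin> S} = {..<n} - S" by auto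
      hence "n - kbar = i - 1" using w(3) k S finS by (simp add: card_Diff_subset)
      thus False using i by simp
    qed
    thus ?thesis using eig_ge_isolated[OF S w(1,2)] w i by (simp add: d lam)
  qed
  have M: "d (n - kbar) \<le> d (n + 1 - kbar) - 1" if between: "0 < kbar" "kbar < n"
  proof -
    have up: "n - card S < n + 1 - kbar" "n + 1 - kbar \<le> n"
      and lo: "1 \<le> n - kbar" "n - kbar \<le> n - card S" using between k by auto
    obtain v where v: "v \<in> S"
      "nth_degree n (ones_edges S) (n + 1 - kbar) = vertex_degree (ones_edges S) (v + 1)"
      using upper[of "n + 1 - kbar"] up by blast
    obtain w where w: "w \<notin> S"
      "nth_degree n (ones_edges S) (n - kbar) = vertex_degree (ones_edges S) (w + 1)"
      using lower[of "n - kbar"] lo by blast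
    show ?thesis using degr_isolated_less_dominating[OF S v(1) w(1) start] v w by (simp add: d)
  qed
  have complete: "0 \<le> d 1 - 1" if full: "kbar = n"
  proof -
    have up: "n - card S < 1" "1 \<le> n" using full k q1n assms(3) by auto
    obtain v where v: "v \<in> S" "card {t \<in> S. v < t} = n - 1"
      "nth_degree n (ones_edges S) 1 = vertex_degree (ones_edges S) (v + 1)"
      using upper[of 1] up by blast
    have "1 \<le> vertex_degree (ones_edges S) (v + 1)"
      using v q1n assms(3) vertex_degree_ones_edges[OF finS, of v] by simp
    thus ?thesis using v(3) by (simp add: d)
  qed
  have nonneg: "0 \<le> lam 1" using eig_nonneg[OF S, of 1] q1n assms(3) by (simp add: lam)

  let ?L1 = "concat (map (\<lambda>i. [lam i, d i - 1]) (rev [n + 1 - kbar..<n + 1]))"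
  let ?L2 = "concat (map (\<lambda>i. [d i, lam i]) (rev [1..<n - kbar + 1]))"
  have L1: "successively (\<ge>) ?L1"
    by (rule successively_interleave) (use A B kn in auto)
  have L2: "successively (\<ge>) ?L2"
    by (rule successively_interleave) (use C D in auto)
  have ends1: "last ?L1 = d (n + 1 - kbar) - 1" if "0 < kbar"
    by (rule interleave_ends) (use that kn in auto)
  have ends2: "hd ?L2 = d (n - kbar)" "last ?L2 = lam 1" "?L2 \<noteq> []" if "kbar < n"
    using interleave_ends[of 1 "n - kbar + 1" d lam] that by simp_all
  have "successively (\<ge>) (?L1 @ ?L2 @ [0])"
  proof (cases "kbar < n")
    case True
    have "successively (\<ge>) (?L2 @ [0])" using L2 ends2[OF True] nonneg by (simp only: successively_append_iff) simp
    moreover have "?L1 = [] \<or> hd (?L2 @ [0]) \<le> last ?L1"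
      using ends1 ends2[OF True] M True by (cases "kbar = 0") (simp_all only: hd_append, simp_all)
    ultimately show ?thesis using L1 by (simp only: successively_append_iff) simp
  next
    case False
    hence "kbar = n" using kn by simp
    thus ?thesis using L1 ends1 complete q1n assms(3)
      by (simp only: successively_append_iff) simp
  qed
  moreover have "d (n - kbar + q 1) \<le> lam (n - kbar + q 1)" if more: "b 1 = 1" "q 1 < kbar"
  proof -
    have low: "{..<q 1} \<subseteq> S" using first more by auto
    have "r \<noteq> 1" using more r assms(8) by auto
    hence "b 2 = 0" "0 < q 2" using assms(2) more(1) r bq by (force simp: alternating_def numeral_2_eq_2)+
    hence qS: "q 1 \<notin> S" unfolding S_def using assms(3) by (intro one_positions_second_block) auto
    have "S = {..<q 1} \<union> {t \<in> S. q 1 < t}"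
      using low qS by (auto simp: not_less)
    moreover have "card ({..<q 1} \<union> {t \<in> S. q 1 < t}) = q 1 + card {t \<in> S. q 1 < t}"
      using finS by (subst card_Un_disjoint) auto
    ultimately have m: "card {t \<in> S. q 1 < t} = kbar - q 1" using k by simp
    have up: "n - card S < n - kbar + q 1" "n - kbar + q 1 \<le> n"
      and "n - (n - kbar + q 1) = kbar - q 1" using more k kn assms(3) by auto
    then obtain v where v: "v \<in> S" "card {t \<in> S. v < t} = kbar - q 1"
      "nth_degree n (ones_edges S) (n - kbar + q 1) = vertex_degree (ones_edges S) (v + 1)"
      using upper[of "n - kbar + q 1"] by fastforce
    have "v < q 1"
    proof (rule ccontr)
      assume "\<not> v < q 1"
      moreover have "v \<noteq> q 1" using v(1) qS by blast
      ultimately have "q 1 < v" by simp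
      hence "{t \<in> S. v < t} \<subseteq> {t \<in> S. q 1 < t}" "v \<in> {t \<in> S. q 1 < t} - {t \<in> S. v < t}"
        using v(1) by auto
      hence "{t \<in> S. v < t} \<subset> {t \<in> S. q 1 < t}" by blast
      hence "card {t \<in> S. v < t} < card {t \<in> S. q 1 < t}" using finS by (intro psubset_card_mono) auto
      thus False using m v(2) by simp
    qed
    hence "vertex_degree (ones_edges S) (v + 1) \<le> q 1 - 1 + (kbar - q 1)"
      using vertex_degree_ones_edges[OF finS, of v] v by simp
    moreover have "real (q 1 - 1) + real (kbar - q 1) \<le> lam (n - (kbar - q 1))"
      using eig_ge_initial_clique[OF S assms(3) _ low qS] more kn m by (simp add: lam)
    moreover have "n - (kbar - q 1) = n - kbar + q 1" using more kn by simp
    ultimately show ?thesis using v(3) by (simp add: d)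
  qed
  ultimately show ?thesis by blast
qed

end
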